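(* In the BCV-space $\mathcal N_{\kappa,\tau}$ the helicoidal surface $\Psi(u,t)=(\xi_1(u),\theta(u,t),\xi_2(u)+a\,\theta(u,t))=\psi_{[U,m,a]}(u,t)$, with $\xi_1,\xi_2,\theta$ determined by the positive function $U(u)$ and the constants $m\neq0$, $a$ as in the context, has constant mean curvature $H$ if and only if $U(u)$ is given (up to a change of the origin of $u$, and with $c$ an arbitrary real constant) by: (1) if $\kappa=\tau=H=0$, $$U^2(u)=\frac{u^2+a^2+c^2/4}{m^2};$$ (2) if $\kappa=4\tau^2\neq-H^2$, $$U^2(u)=\frac{c_1+\sqrt{c_1^2+c_2(H^2+4\tau^2)}\,\sin(\sqrt{4\tau^2+H^2}\,u)}{m^2(H^2+4\tau^2)};$$ (3) if $-H^2=\kappa\neq4\tau^2$, $$U^2(u)=\frac{\big(\frac{b_1}{2}u^2+b_2\big)^2+b_3}{m^2(4\tau^2+H^2)};$$ (4) if $-H^2<\kappa\neq4\tau^2$, $$U^2(u)=\frac{(H^2+\kappa)^2b_3+\big[b_1+\sqrt{b_1^2+b(H^2+\kappa)}\,\sin(\sqrt{H^2+\kappa}\,u)\big]^2}{m^2(4\tau^2-\kappa)(H^2+\kappa)^2};$$ (5) if $-H^2>\kappa\neq4\tau^2$, $$U^2(u)=\begin{cases}\dfrac{(H^2+\kappa)^2b_3+\big[b_1-\sqrt{-b_1^2-b(H^2+\kappa)}\,\sinh(\sqrt{-(H^2+\kappa)}\,u)\big]^2}{m^2(4\tau^2-\kappa)(H^2+\kappa)^2},& b_1^2+b(H^2+\kappa)<0,\\[3mm]\dfrac{(H^2+\kappa)^2b_3+\big[b_1-\sqrt{b_1^2+b(H^2+\kappa)}\,\cosh(\sqrt{-(H^2+\kappa)}\,u)\big]^2}{m^2(4\tau^2-\kappa)(H^2+\kappa)^2},&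 b_1^2+b(H^2+\kappa)>0.\end{cases}$$ Here $b,b_i,c_i\in\mathbb R$ are the constants $$\begin{aligned}b&=(1-2a\tau)[\kappa(1+2a\tau)-8\tau^2]-c^2,& b_1&=4\tau^2-2a\kappa\tau-cH,\\ b_2&=-\frac{b}{2b_1},& b_3&=4a\tau-a^2\kappa-1,\\ c_1&=1+(1-2a\tau)^2-cH,& c_2&=-c^2-4a^2(1-a\tau)^2.\end{aligned}$$ These expressions define a $1$-parameter family $\{U_c(u)\}$ of functions $U(u)$ such that the helicoidal surface $\psi_{[U_c,m,a]}(u,t)$ has constant mean curvature equal to $H$.
   Context: For $\kappa,\tau\in\mathbb R$, the Bianchi-Cartan-Vranceanu (BCV) space $\mathcal N_{\kappa,\tau}$ is the open subset of $\mathbb R^3$ where $B=1+\frac{\kappa}{4}(x^2+y^2)>0$, with the metric $g_{\kappa,\tau}=\frac{dx^2+dy^2}{B^2}+\big(dz+\tau\frac{y\,dx-x\,dy}{B}\big)^2$. Cylindrical coordinates $(r,\theta,z)$ with $x=r\cos\theta$, $y=r\sin\theta$ are used. Given a function $U(u)>0$ and constants $m\ne0$, $a$, put $$\Delta=(1-2a\tau)^2+(m^2U^2-a^2)(4\tau^2-\kappa),\qquad \xi_1=2\sqrt{\frac{m^2U^2-a^2}{(1+\sqrt\Delta)^2-4\tau^2m^2U^2}},$$ $$\xi_2=\int\frac{mU(4+\kappa\xi_1^2)}{4\xi_1^2}\sqrt{\xi_1^2-\frac{m^4U^2U'^2(4+\kappa\xi_1^2)^2}{16\Delta}}\,du,$$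 $$\theta(u,t)=\frac tm+\int\frac{(4\tau-a\kappa)\xi_1^2-4a}{4mU\xi_1^2}\sqrt{\xi_1^2-\frac{m^4U^2U'^2(4+\kappa\xi_1^2)^2}{16\Delta}}\,du .$$ Then $\psi_{[U,m,a]}(u,t)=(\xi_1(u),\theta(u,t),\xi_2(u)+a\theta(u,t))$ in cylindrical coordinates is a helicoidal surface (invariant under the isometries generated by $\partial_\theta+a\,\partial_z$) with first fundamental form $du^2+U^2dt^2$. Mean curvature is the trace of the second fundamental form (not divided by 2). In terms of the profile curve, with $B=1+\frac\kappa4\xi_1^2$, $\xi_1'=B\cos\sigma$ and $\xi_2'=\frac{\sqrt{\xi_1^2+(aB-\tau\xi_1^2)^2}}{\xi_1}\sin\sigma$, it is $H=\sigma'+\big(\frac1{\xi_1}-\frac\kappa4\xi_1\big)\sin\sigma$.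
   Formalization: In cases (3)–(5) the squared bracket (divided by H²+κ in (4), (5)) is also required to be positive, i.e. to equal √Δ; without this the "if" part fails, e.g. κ=−1, τ=a=m=1, H=c=0, small u>0. Mean curvature H is meant for one of the two unit normals. *)

theory Defs
  imports "HOL-Analysis.Analysis"
begin

text \<open>A metric is a function \<open>g\<close> with \<open>g p v w\<close> the inner product of the tangent vectors
  \<open>v\<close> and \<open>w\<close> at the point \<open>p\<close>.\<close>

type_synonym 'a metric = "'a \<Rightarrow> 'a \<Rightarrow> 'a \<Rightarrow> real"

text \<open>Christoffel symbols of the first kind,
  \<open>(\<partial>\<^sub>i g\<^sub>j\<^sub>k + \<partial>\<^sub>j g\<^sub>i\<^sub>k - \<partial>\<^sub>k g\<^sub>i\<^sub>j) / 2\<close>, contracted with \<open>v\<^sup>i w\<^sup>j z\<^sup>k\<close>. For vector fields \<open>V\<close> and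
  \<open>W\<close> this gives \<open>g(\<nabla>\<^sub>V W, Z) = g(D\<^sub>V W, Z) + christoffel g p V W Z\<close> for the Levi-Civita connection,
  with \<open>D\<close> the flat derivative.\<close>

definition christoffel :: "('a::euclidean_space) metric \<Rightarrow> 'a \<Rightarrow> 'a \<Rightarrow> 'a \<Rightarrow> 'a \<Rightarrow> real" where
  "christoffel g p v w z =
     (frechet_derivative (\<lambda>q. g q w z) (at p) v
      + frechet_derivative (\<lambda>q. g q v z) (at p) w
      - frechet_derivative (\<lambda>q. g q v w) (at p) z) / 2"

definition D\<^sub>u :: "(real \<Rightarrow> real \<Rightarrow> 'a::euclidean_space) \<Rightarrow> real \<Rightarrow> real \<Rightarrow> 'a" where
  "D\<^sub>u \<psi> u t = vector_derivative (\<lambda>v. \<psi> v t) (at u)"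

definition D\<^sub>t :: "(real \<Rightarrow> real \<Rightarrow> 'a::euclidean_space) \<Rightarrow> real \<Rightarrow> real \<Rightarrow> 'a" where
  "D\<^sub>t \<psi> u t = vector_derivative (\<lambda>s. \<psi> u s) (at t)"

definition unit_normal_field ::
    "('a::euclidean_space) metric \<Rightarrow> (real \<times> real) set \<Rightarrow> (real \<Rightarrow> real \<Rightarrow> 'a) \<Rightarrow> (real \<Rightarrow> real \<Rightarrow> 'a) \<Rightarrow> bool" where
  "unit_normal_field g S \<psi> N \<longleftrightarrow>
     continuous_on S (\<lambda>(u, t). N u t) \<and>
     (\<forall>(u, t) \<in> S. g (\<psi> u t) (N u t) (N u t) = 1 \<and>
                   g (\<psi> u t) (N u t) (D\<^sub>u \<psi> u t) = 0 \<and>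
                   g (\<psi> u t) (N u t) (D\<^sub>t \<psi> u t) = 0)"

text \<open>The trace of the second fundamental form with respect to the first one, not divided by 2.\<close>

definition mean_curvature ::
    "('a::euclidean_space) metric \<Rightarrow> (real \<Rightarrow> real \<Rightarrow> 'a) \<Rightarrow> (real \<Rightarrow> real \<Rightarrow> 'a) \<Rightarrow> real \<Rightarrow> real \<Rightarrow> real" where
  "mean_curvature g \<psi> N u t =
     (let p = \<psi> u t; n = N u t; X = D\<^sub>u \<psi> u t; Y = D\<^sub>t \<psi> u t;
          E = g p X X; F = g p X Y; G = g p Y Y;
          L = g p (D\<^sub>u (D\<^sub>u \<psi>) u t) n + christoffel g p X X n;
          M = g p (D\<^sub>u (D\<^sub>t \<psi>) u t) n + christoffel g p X Y n;
          R = g p (D\<^sub>t (D\<^sub>t \<psi>) u t) n + christoffel g p Y Y n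
      in (G * L - 2 * F * M + E * R) / (E * G - F\<^sup>2))"

text \<open>The surface is not oriented in advance: the mean curvature is \<open>H\<close> for one of the two unit
  normal fields.\<close>

definition has_constant_mean_curvature ::
    "('a::euclidean_space) metric \<Rightarrow> (real \<times> real) set \<Rightarrow> (real \<Rightarrow> real \<Rightarrow> 'a) \<Rightarrow> real \<Rightarrow> bool" where
  "has_constant_mean_curvature g S \<psi> H \<longleftrightarrow>
     (\<exists>N. unit_normal_field g S \<psi> N \<and> (\<forall>(u, t) \<in> S. mean_curvature g \<psi> N u t = H))"


definition bcv_space :: "real \<Rightarrow> (real \<times> real \<times> real) set" where
  "bcv_space \<kappa> = {(x, y, z). 1 + \<kappa> / 4 * (x\<^sup>2 + y\<^sup>2) > 0}"

fun bcv_metric :: "real \<Rightarrow> real \<Rightarrow> (real \<times> real \<times> real) metric" where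
  "bcv_metric \<kappa> \<tau> (x, y, z) (v1, v2, v3) (w1, w2, w3) =
     (let B = 1 + \<kappa> / 4 * (x\<^sup>2 + y\<^sup>2)
      in (v1 * w1 + v2 * w2) / B\<^sup>2
         + (v3 + \<tau> * (y * v1 - x * v2) / B) * (w3 + \<tau> * (y * w1 - x * w2) / B))"

definition cylindrical :: "real \<Rightarrow> real \<Rightarrow> real \<Rightarrow> real \<times> real \<times> real" where
  "cylindrical r \<theta> z = (r * cos \<theta>, r * sin \<theta>, z)"


definition hel_Delta :: "real \<Rightarrow> real \<Rightarrow> (real \<Rightarrow> real) \<Rightarrow> real \<Rightarrow> real \<Rightarrow> real \<Rightarrow> real" where
  "hel_Delta \<kappa> \<tau> U m a u = (1 - 2 * a * \<tau>)\<^sup>2 + (m\<^sup>2 * (U u)\<^sup>2 - a\<^sup>2) * (4 * \<tau>\<^sup>2 - \<kappa>)"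

definition hel_xi1_radicand :: "real \<Rightarrow> real \<Rightarrow> (real \<Rightarrow> real) \<Rightarrow> real \<Rightarrow> real \<Rightarrow> real \<Rightarrow> real" where
  "hel_xi1_radicand \<kappa> \<tau> U m a u =
     (m\<^sup>2 * (U u)\<^sup>2 - a\<^sup>2)
       / ((1 + sqrt (hel_Delta \<kappa> \<tau> U m a u))\<^sup>2 - 4 * \<tau>\<^sup>2 * m\<^sup>2 * (U u)\<^sup>2)"

definition hel_xi1 :: "real \<Rightarrow> real \<Rightarrow> (real \<Rightarrow> real) \<Rightarrow> real \<Rightarrow> real \<Rightarrow> real \<Rightarrow> real" where
  "hel_xi1 \<kappa> \<tau> U m a u = 2 * sqrt (hel_xi1_radicand \<kappa> \<tau> U m a u)"

definition hel_radicand :: "real \<Rightarrow> real \<Rightarrow> (real \<Rightarrow> real) \<Rightarrow> real \<Rightarrow> real \<Rightarrow> real \<Rightarrow> real" where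
  "hel_radicand \<kappa> \<tau> U m a u =
     (hel_xi1 \<kappa> \<tau> U m a u)\<^sup>2
     - m^4 * (U u)\<^sup>2 * (deriv U u)\<^sup>2 * (4 + \<kappa> * (hel_xi1 \<kappa> \<tau> U m a u)\<^sup>2)\<^sup>2
         / (16 * hel_Delta \<kappa> \<tau> U m a u)"

definition hel_xi2_integrand :: "real \<Rightarrow> real \<Rightarrow> (real \<Rightarrow> real) \<Rightarrow> real \<Rightarrow> real \<Rightarrow> real \<Rightarrow> real" where
  "hel_xi2_integrand \<kappa> \<tau> U m a u =
     m * U u * (4 + \<kappa> * (hel_xi1 \<kappa> \<tau> U m a u)\<^sup>2) / (4 * (hel_xi1 \<kappa> \<tau> U m a u)\<^sup>2)
       * sqrt (hel_radicand \<kappa> \<tau> U m a u)"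

definition hel_theta_integrand :: "real \<Rightarrow> real \<Rightarrow> (real \<Rightarrow> real) \<Rightarrow> real \<Rightarrow> real \<Rightarrow> real \<Rightarrow> real" where
  "hel_theta_integrand \<kappa> \<tau> U m a u =
     ((4 * \<tau> - a * \<kappa>) * (hel_xi1 \<kappa> \<tau> U m a u)\<^sup>2 - 4 * a)
         / (4 * m * U u * (hel_xi1 \<kappa> \<tau> U m a u)\<^sup>2)
       * sqrt (hel_radicand \<kappa> \<tau> U m a u)"

text \<open>The conditions under which the formulas make sense and give a surface of class \<open>C\<^sup>2\<close>. The last
  one is needed for \<open>\<xi>\<^sub>2\<close> and \<open>\<theta>\<close> to be \<open>C\<^sup>2\<close>: the square root of a smooth nonnegative function
  can have a corner at a zero, and there the surface has no mean curvature. Zeros of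
  \<open>hel_radicand\<close> are not excluded, since the minimal helicoids have \<open>hel_radicand = 0\<close> throughout.\<close>

definition hel_regular :: "real \<Rightarrow> real \<Rightarrow> (real \<Rightarrow> real) \<Rightarrow> real \<Rightarrow> real \<Rightarrow> real set \<Rightarrow> bool" where
  "hel_regular \<kappa> \<tau> U m a I \<longleftrightarrow>
     open I \<and> is_interval I \<and> I \<noteq> {} \<and>
     (\<forall>u\<in>I. U u > 0) \<and> U C1_differentiable_on I \<and> deriv U C1_differentiable_on I \<and>
     (\<forall>u\<in>I. hel_Delta \<kappa> \<tau> U m a u > 0 \<and> hel_xi1_radicand \<kappa> \<tau> U m a u > 0
             \<and> hel_radicand \<kappa> \<tau> U m a u \<ge> 0) \<and>
     (\<lambda>u. sqrt (hel_radicand \<kappa> \<tau> U m a u)) C1_differentiable_on I"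

text \<open>\<open>\<psi>\<close> is a surface \<open>\<psi>\<^bsub>[U,m,a]\<^esub>\<close> in the BCV space, over \<open>u \<in> I\<close> and \<open>t \<in> \<real>\<close>. The indefinite
  integrals are arbitrary antiderivatives \<open>\<xi>2\<close> and \<open>\<Theta>\<close>.\<close>

definition helicoidal_surface ::
    "real \<Rightarrow> real \<Rightarrow> (real \<Rightarrow> real) \<Rightarrow> real \<Rightarrow> real \<Rightarrow> real set \<Rightarrow> (real \<Rightarrow> real \<Rightarrow> real \<times> real \<times> real) \<Rightarrow> bool" where
  "helicoidal_surface \<kappa> \<tau> U m a I \<psi> \<longleftrightarrow>
     hel_regular \<kappa> \<tau> U m a I \<and>
     (\<exists>\<xi>2 \<Theta>. \<forall>u\<in>I.
        (\<xi>2 has_real_derivative hel_xi2_integrand \<kappa> \<tau> U m a u) (at u) \<and>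
        (\<Theta> has_real_derivative hel_theta_integrand \<kappa> \<tau> U m a u) (at u) \<and>
        (\<forall>t. \<psi> u t \<in> bcv_space \<kappa> \<and>
             (let \<theta> = t / m + \<Theta> u
              in \<psi> u t = cylindrical (hel_xi1 \<kappa> \<tau> U m a u) \<theta> (\<xi>2 u + a * \<theta>))))"


definition const_b :: "real \<Rightarrow> real \<Rightarrow> real \<Rightarrow> real \<Rightarrow> real" where
  "const_b \<kappa> \<tau> a c = (1 - 2 * a * \<tau>) * (\<kappa> * (1 + 2 * a * \<tau>) - 8 * \<tau>\<^sup>2) - c\<^sup>2"

definition const_b1 :: "real \<Rightarrow> real \<Rightarrow> real \<Rightarrow> real \<Rightarrow> real \<Rightarrow> real" where
  "const_b1 \<kappa> \<tau> H a c = 4 * \<tau>\<^sup>2 - 2 * a * \<kappa> * \<tau> - c * H"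

definition const_b2 :: "real \<Rightarrow> real \<Rightarrow> real \<Rightarrow> real \<Rightarrow> real \<Rightarrow> real" where
  "const_b2 \<kappa> \<tau> H a c = - const_b \<kappa> \<tau> a c / (2 * const_b1 \<kappa> \<tau> H a c)"

definition const_b3 :: "real \<Rightarrow> real \<Rightarrow> real \<Rightarrow> real" where
  "const_b3 \<kappa> \<tau> a = 4 * a * \<tau> - a\<^sup>2 * \<kappa> - 1"

definition const_c1 :: "real \<Rightarrow> real \<Rightarrow> real \<Rightarrow> real \<Rightarrow> real" where
  "const_c1 \<tau> H a c = 1 + (1 - 2 * a * \<tau>)\<^sup>2 - c * H"

definition const_c2 :: "real \<Rightarrow> real \<Rightarrow> real \<Rightarrow> real" where
  "const_c2 \<tau> a c = - c\<^sup>2 - 4 * a\<^sup>2 * (1 - a * \<tau>)\<^sup>2"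

text \<open>\<open>cmc_profile \<kappa> \<tau> H m a c u y\<close>: \<open>y\<close> is the value at \<open>u\<close> of the function \<open>U\<close> with constant \<open>c\<close>.
  A formula with a square root carries the condition that the root is real.

  For \<open>\<kappa> \<noteq> 4 \<tau>\<^sup>2\<close> the formulas come from \<open>m\<^sup>2 U\<^sup>2 (4 \<tau>\<^sup>2 - \<kappa>) = \<Delta> + b\<^sub>3\<close> by inserting the solution of a
  differential equation for \<open>\<surd>\<Delta>\<close>. This solution is \<open>w\<close> if \<open>\<kappa> = - H\<^sup>2\<close> and \<open>w / (H\<^sup>2 + \<kappa>)\<close> otherwise,
  so it has to be positive, which is lost on squaring. Without the sign the formulas would not imply
  constant mean curvature: for \<open>\<kappa> = -1\<close>, \<open>\<tau> = a = m = 1\<close>, \<open>H = c = 0\<close> and small \<open>u > 0\<close> the solution is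
  negative, and the surface \<open>\<psi>\<^bsub>[U,m,a]\<^esub>\<close> exists but is not minimal.

  For \<open>\<kappa> = - H\<^sup>2 \<noteq> 4 \<tau>\<^sup>2\<close>, \<open>b\<^sub>1 = 0\<close> implies \<open>H\<^sup>2 b = - (H\<^sup>2 + 4 \<tau>\<^sup>2)\<^sup>2\<close> with \<open>H \<noteq> 0\<close>. Then
  \<open>(\<surd>\<Delta>)'\<^sup>2 = 2 b\<^sub>1 \<surd>\<Delta> + b\<close> has no solution; \<open>cmc_profile\<close> is false, because \<open>b\<^sub>2\<close> is a division by
  \<open>0\<close> and so \<open>w = 0\<close>.\<close>

definition cmc_profile ::
    "real \<Rightarrow> real \<Rightarrow> real \<Rightarrow> real \<Rightarrow> real \<Rightarrow> real \<Rightarrow> real \<Rightarrow> real \<Rightarrow> bool" where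
  "cmc_profile \<kappa> \<tau> H m a c u y \<longleftrightarrow>
    (let b = const_b \<kappa> \<tau> a c; b1 = const_b1 \<kappa> \<tau> H a c; b2 = const_b2 \<kappa> \<tau> H a c;
         b3 = const_b3 \<kappa> \<tau> a; c1 = const_c1 \<tau> H a c; c2 = const_c2 \<tau> a c
     in
      (\<kappa> = 0 \<and> \<tau> = 0 \<and> H = 0 \<longrightarrow>
         y\<^sup>2 = (u\<^sup>2 + a\<^sup>2 + c\<^sup>2 / 4) / m\<^sup>2) \<and>
      (\<kappa> = 4 * \<tau>\<^sup>2 \<and> \<kappa> \<noteq> - H\<^sup>2 \<longrightarrow>
         c1\<^sup>2 + c2 * (H\<^sup>2 + 4 * \<tau>\<^sup>2) \<ge> 0 \<and>
         y\<^sup>2 = (c1 + sqrt (c1\<^sup>2 + c2 * (H\<^sup>2 + 4 * \<tau>\<^sup>2)) * sin (sqrt (4 * \<tau>\<^sup>2 + H\<^sup>2) * u))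
               / (m\<^sup>2 * (H\<^sup>2 + 4 * \<tau>\<^sup>2))) \<and>
      (- H\<^sup>2 = \<kappa> \<and> \<kappa> \<noteq> 4 * \<tau>\<^sup>2 \<longrightarrow>
         (let w = b1 / 2 * u\<^sup>2 + b2
          in w > 0 \<and> y\<^sup>2 = (w\<^sup>2 + b3) / (m\<^sup>2 * (4 * \<tau>\<^sup>2 + H\<^sup>2)))) \<and>
      (- H\<^sup>2 < \<kappa> \<and> \<kappa> \<noteq> 4 * \<tau>\<^sup>2 \<longrightarrow>
         b1\<^sup>2 + b * (H\<^sup>2 + \<kappa>) \<ge> 0 \<and>
         (let w = b1 + sqrt (b1\<^sup>2 + b * (H\<^sup>2 + \<kappa>)) * sin (sqrt (H\<^sup>2 + \<kappa>) * u)
          in w / (H\<^sup>2 + \<kappa>) > 0 \<and>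
             y\<^sup>2 = ((H\<^sup>2 + \<kappa>)\<^sup>2 * b3 + w\<^sup>2) / (m\<^sup>2 * (4 * \<tau>\<^sup>2 - \<kappa>) * (H\<^sup>2 + \<kappa>)\<^sup>2))) \<and>
      (- H\<^sup>2 > \<kappa> \<and> \<kappa> \<noteq> 4 * \<tau>\<^sup>2 \<longrightarrow>
         b1\<^sup>2 + b * (H\<^sup>2 + \<kappa>) \<noteq> 0 \<and>
         (let w = (if b1\<^sup>2 + b * (H\<^sup>2 + \<kappa>) < 0
                   then b1 - sqrt (- b1\<^sup>2 - b * (H\<^sup>2 + \<kappa>)) * sinh (sqrt (- (H\<^sup>2 + \<kappa>)) * u)
                   else b1 - sqrt (b1\<^sup>2 + b * (H\<^sup>2 + \<kappa>)) * cosh (sqrt (- (H\<^sup>2 + \<kappa>)) * u))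
          in w / (H\<^sup>2 + \<kappa>) > 0 \<and>
             y\<^sup>2 = ((H\<^sup>2 + \<kappa>)\<^sup>2 * b3 + w\<^sup>2) / (m\<^sup>2 * (4 * \<tau>\<^sup>2 - \<kappa>) * (H\<^sup>2 + \<kappa>)\<^sup>2))))"

end

theory Submission
  imports Defs
begin

text \<open>Apply the rotation by \<open>\<theta>\<close> to reduce all computations to the points \<open>(\<rho>, 0, z)\<close>. With
  \<open>p = \<xi>\<^sub>1\<^sup>2 / B\<close> and \<open>W = \<xi>\<^sub>1 sin \<sigma> / B\<close>, the formula for the mean curvature \<open>H\<close> becomes
  \<open>W' = H p' / 2\<close> and \<open>p'' = 2 - \<kappa> p - 2 H W\<close>. For constant \<open>H\<close> the first equation
  integrates to \<open>W = H p / 2 + k\<close>, and then \<open>p\<close> satisfies the linear equation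
  \<open>p'' = 2 - 2 H k - (H\<^sup>2 + \<kappa>) p\<close> with first integral
  \<open>p'\<^sup>2 = - 4 k\<^sup>2 + 2 (2 - 2 H k) p - (H\<^sup>2 + \<kappa>) p\<^sup>2\<close>. As \<open>m\<^sup>2 U\<^sup>2\<close> (for \<open>\<kappa> = 4 \<tau>\<^sup>2\<close>) or \<open>\<surd>\<Delta>\<close> (otherwise)
  is an affine function of \<open>p\<close>, it satisfies an equation of the same form, whose coefficients are the
  constants of the theorem; \<open>c\<close> is an affine function of \<open>k\<close>. For \<open>\<kappa> < - H\<^sup>2\<close> the discriminant
  \<open>b\<^sub>1\<^sup>2 + b (H\<^sup>2 + \<kappa>)\<close> is always positive, so that the branch with \<open>sinh\<close> does not occur.\<close>

subsection \<open>The BCV metric in a rotated orthonormal frame\<close>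

text \<open>The delicate direction leads from the profile back to the mean curvature. The equations
  for \<open>p\<close> determine only the square of \<open>W\<close> and the product of
  \<open>W\<close> with the mean curvature, so the sign of \<open>H\<close> has to be recovered, and
  it must be the same on the whole interval. Continuity and connectedness give this away from the
  zeros of \<open>W\<close>. At a zero, \<open>W \<ge> 0\<close> equals the absolute value of
  \<open>H p / 2 + k\<close>, and its differentiability there forces \<open>H = 0\<close>. The
  choice of the unit normal raises the same question over the parameter domain and has the same
  answer. Two further signs are lost on squaring. Positivity of \<surd>\<Delta> decides between the
  two roots when \<open>U^2\<close> is translated into \<surd>\<Delta>; positivity of
  \<open>p\<close> decides between the two branches of the hyperbola that the first integral
  describes for \<kappa> < - H^2.\<close>

definition bcv_dmetric :: "real \<Rightarrow> real \<Rightarrow> real \<times> real \<times> real \<Rightarrow> real \<times> real \<times> real \<Rightarrow> real \<times> real \<times> real \<Rightarrow> real \<times> real \<times> real \<Rightarrow> real" where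
  "bcv_dmetric \<kappa> \<tau> p d v w = (case p of (x, y, z) \<Rightarrow> case d of (d1, d2, d3) \<Rightarrow> case v of (v1, v2, v3) \<Rightarrow> case w of (w1, w2, w3) \<Rightarrow>
     let B = 1 + \<kappa> / 4 * (x\<^sup>2 + y\<^sup>2); dB = \<kappa> / 2 * (x * d1 + y * d2)
      in - 2 * dB * (v1 * w1 + v2 * w2) / B ^ 3
         + (\<tau> * (d2 * v1 - d1 * v2) / B - \<tau> * (y * v1 - x * v2) * dB / B\<^sup>2) * (w3 + \<tau> * (y * w1 - x * w2) / B)
         + (v3 + \<tau> * (y * v1 - x * v2) / B) * (\<tau> * (d2 * w1 - d1 * w2) / B - \<tau> * (y * w1 - x * w2) * dB / B\<^sup>2))"

lemma bcv_metric_has_derivative: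
  assumes "p \<in> bcv_space \<kappa>"
  shows "((\<lambda>q. bcv_metric \<kappa> \<tau> q v w) has_derivative (\<lambda>d. bcv_dmetric \<kappa> \<tau> p d v w)) (at p)"
proof -
  obtain x y z where p: "p = (x, y, z)" by (cases p)
  obtain v1 v2 v3 where v: "v = (v1, v2, v3)" by (cases v)
  obtain w1 w2 w3 where w: "w = (w1, w2, w3)" by (cases w)
  define B where "B q = 1 + \<kappa> / 4 * ((fst q)\<^sup>2 + (fst (snd q))\<^sup>2)" for q :: "real \<times> real \<times> real"
  define dB where "dB d = \<kappa> / 2 * (x * fst d + y * fst (snd d))" for d :: "real \<times> real \<times> real"
  \<comment> \<open>\<open>\<eta>\<close> is the 1-form dz + \<tau> (y dx - x dy) / B. The metric is
    the flat plane metric over \<open>B^2\<close> plus the square of this form, so the derivative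
    consists of a quotient rule and a product rule.\<close>
  define \<eta> where "\<eta> v1 v2 v3 q = v3 + \<tau> * (fst (snd q) * v1 - fst q * v2) / B q"
    for v1 v2 v3 and q :: "real \<times> real \<times> real"
  define d\<eta> where "d\<eta> v1 v2 d = \<tau> * (fst (snd d) * v1 - fst d * v2) / B p
      - \<tau> * (y * v1 - x * v2) * dB d / (B p)\<^sup>2"
    for v1 v2 and d :: "real \<times> real \<times> real"
  have B0: "B p \<noteq> 0"
    using assms by (simp add: p B_def bcv_space_def)
  have B: "(B has_derivative dB) (at p)"
    unfolding B_def dB_def p
    by (auto intro!: derivative_eq_intros simp: fun_eq_iff algebra_simps)
  have \<eta>: "(\<eta> v1 v2 v3 has_derivative d\<eta> v1 v2) (at p)" for v1 v2 v3
    unfolding \<eta>_def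
    by (rule derivative_eq_intros B B0 refl)+
      (use B0 in \<open>simp add: fun_eq_iff d\<eta>_def p field_simps power2_eq_square\<close>)
  have Bq: "((\<lambda>q. K / (B q)\<^sup>2) has_derivative (\<lambda>d. - 2 * dB d * K / (B p) ^ 3)) (at p)" for K
    by (rule derivative_eq_intros B refl)+
      (use B0 in \<open>simp_all add: fun_eq_iff field_simps power2_eq_square power3_eq_cube\<close>)
  have "((\<lambda>q. (v1 * w1 + v2 * w2) / (B q)\<^sup>2 + \<eta> v1 v2 v3 q * \<eta> w1 w2 w3 q) has_derivative
      (\<lambda>d. - 2 * dB d * (v1 * w1 + v2 * w2) / (B p) ^ 3
         + d\<eta> v1 v2 d * \<eta> w1 w2 w3 p + \<eta> v1 v2 v3 p * d\<eta> w1 w2 d)) (at p)"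
    by (rule has_derivative_eq_rhs[OF has_derivative_add[OF Bq has_derivative_mult[OF \<eta> \<eta>]]])
      (simp add: fun_eq_iff)
  moreover have "(\<lambda>q. bcv_metric \<kappa> \<tau> q v w) =
      (\<lambda>q. (v1 * w1 + v2 * w2) / (B q)\<^sup>2 + \<eta> v1 v2 v3 q * \<eta> w1 w2 w3 q)"
    by (auto simp: fun_eq_iff v w Let_def B_def \<eta>_def)
  moreover have "(\<lambda>d. bcv_dmetric \<kappa> \<tau> p d v w) = (\<lambda>d. - 2 * dB d * (v1 * w1 + v2 * w2) / (B p) ^ 3
         + d\<eta> v1 v2 d * \<eta> w1 w2 w3 p + \<eta> v1 v2 v3 p * d\<eta> w1 w2 d)"
    by (auto simp: fun_eq_iff v w Let_def bcv_dmetric_def p B_def \<eta>_def dB_def d\<eta>_def)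
  ultimately show ?thesis by simp
qed

lemma christoffel_bcv:
  assumes "p \<in> bcv_space \<kappa>"
  shows "christoffel (bcv_metric \<kappa> \<tau>) p v w z =
     (bcv_dmetric \<kappa> \<tau> p v w z + bcv_dmetric \<kappa> \<tau> p w v z - bcv_dmetric \<kappa> \<tau> p z v w) / 2"
  unfolding christoffel_def
  using bcv_metric_has_derivative[OF assms, THEN frechet_derivative_at, symmetric] by simp

text \<open>A rotation about the z-axis is linear, hence its own differential: one function moves
  points and tangent vectors alike.\<close>

definition rot :: "real \<Rightarrow> real \<times> real \<times> real \<Rightarrow> real \<times> real \<times> real" where
  "rot \<theta> v = (case v of (v1, v2, v3) \<Rightarrow> (v1 * cos \<theta> - v2 * sin \<theta>, v1 * sin \<theta> + v2 * cos \<theta>, v3))"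

text \<open>Apart from the fixed third components, the metric involves only the radius (through
  \<open>B\<close>), a plane dot product and a plane cross product. Invariance of these three yields
  all invariance statements below.\<close>

lemma rot_radius: "(x * cos \<theta> - y * sin \<theta>)\<^sup>2 + (x * sin \<theta> + y * cos \<theta>)\<^sup>2 = x\<^sup>2 + y\<^sup>2"
  for x y :: real
  using sin_cos_squared_add[of \<theta>] by algebra

lemma rot_dot: "(x * cos \<theta> - y * sin \<theta>) * (v * cos \<theta> - w * sin \<theta>)
   + (x * sin \<theta> + y * cos \<theta>) * (v * sin \<theta> + w * cos \<theta>) = x * v + y * w"
  for x y v w :: real
  using sin_cos_squared_add[of \<theta>] by algebra

lemma rot_cross: "(x * sin \<theta> + y * cos \<theta>) * (v * cos \<theta> - w * sin \<theta>)
   - (x * cos \<theta> - y * sin \<theta>) * (v * sin \<theta> + w * cos \<theta>) = y * v - x * w"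
  for x y v w :: real
  using sin_cos_squared_add[of \<theta>] by algebra

lemma bcv_space_rot: "rot \<theta> p \<in> bcv_space \<kappa> \<longleftrightarrow> p \<in> bcv_space \<kappa>"
  by (auto simp: rot_def bcv_space_def rot_radius split_beta)

lemma bcv_metric_rot: "bcv_metric \<kappa> \<tau> (rot \<theta> p) (rot \<theta> v) (rot \<theta> w) = bcv_metric \<kappa> \<tau> p v w"
  by (cases p; cases v; cases w) (simp add: rot_def Let_def rot_radius rot_dot rot_cross)

text \<open>Christoffel symbols are not tensorial, but a linear isometry has no second derivative
  and carries them along like tensors. This is what permits computing at angle 0.\<close>

lemma bcv_dmetric_rot:
  "bcv_dmetric \<kappa> \<tau> (rot \<theta> p) (rot \<theta> d) (rot \<theta> v) (rot \<theta> w) = bcv_dmetric \<kappa> \<tau> p d v w"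
  by (cases p; cases d; cases v; cases w) (simp add: rot_def bcv_dmetric_def Let_def rot_radius rot_dot rot_cross)

text \<open>A moving frame rule: the turning of the frame adds \<open>\<theta>'\<close> times the
  quarter turn of the plane components. Both positions and velocities are differentiated with
  it.\<close>

lemma rot_has_vector_derivative:
  assumes "(\<theta> has_real_derivative \<theta>') (at u)"
    and "(f has_real_derivative f') (at u)" "(g has_real_derivative g') (at u)"
    and "(h has_real_derivative h') (at u)"
  shows "((\<lambda>u. rot (\<theta> u) (f u, g u, h u)) has_vector_derivative
           rot (\<theta> u) (f' - \<theta>' * g u, g' + \<theta>' * f u, h')) (at u)"
  unfolding rot_def prod.case
  using assms
  by (intro has_vector_derivative_Pair; unfold has_real_derivative_iff_has_vector_derivative[symmetric])
     (auto intro!: derivative_eq_intros simp: algebra_simps)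

section \<open>Components in an orthonormal frame at points with y = 0\<close>

lemma bcv_metric_axis:
  fixes \<kappa> \<rho> B :: real
  assumes "B = 1 + \<kappa> / 4 * \<rho>\<^sup>2" "B > 0"
  shows "bcv_metric \<kappa> \<tau> (\<rho>, 0, z) (v1, v2, v3) (w1, w2, w3) =
    (v1 * w1 + v2 * w2) / B\<^sup>2 + (v3 - \<tau> * \<rho> * v2 / B) * (w3 - \<tau> * \<rho> * w2 / B)"
  using assms by (simp add: Let_def mult.assoc)

text \<open>Coordinates of a tangent vector at \<open>(\<rho>, 0, z)\<close> whose components in the orthonormal frame dual to
  \<open>dx / B\<close>, \<open>dy / B\<close>, \<open>dz - \<tau> \<rho> dy / B\<close> are given.\<close>

definition frame :: "real \<Rightarrow> real \<Rightarrow> real \<Rightarrow> real \<times> real \<times> real \<Rightarrow> real \<times> real \<times> real" where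
  "frame \<tau> \<rho> B e = (case e of (e1, e2, e3) \<Rightarrow> (B * e1, B * e2, e3 + \<tau> * \<rho> * e2))"

lemma bcv_metric_frame:
  assumes "B = 1 + \<kappa> / 4 * \<rho>\<^sup>2" "B > 0"
  shows "bcv_metric \<kappa> \<tau> (\<rho>, 0, z) (frame \<tau> \<rho> B (v1, v2, v3)) (frame \<tau> \<rho> B (w1, w2, w3)) =
    v1 * w1 + v2 * w2 + v3 * w3"
  unfolding frame_def prod.case bcv_metric_axis[OF assms]
  using assms(2) by (simp add: field_simps power2_eq_square)

text \<open>The factors \<open>B\<close> in \<open>frame\<close> cancel every denominator. Since the
  result is polynomial, the later curvature computation is ring algebra apart from
  \<open>1 / \<rho>\<close>.\<close>

lemma bcv_dmetric_frame:
  assumes "B = 1 + \<kappa> / 4 * \<rho>\<^sup>2" "B > 0"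
  shows "bcv_dmetric \<kappa> \<tau> (\<rho>, 0, z) (frame \<tau> \<rho> B (d1, d2, d3)) (frame \<tau> \<rho> B (v1, v2, v3)) (frame \<tau> \<rho> B (w1, w2, w3)) =
    - \<kappa> * \<rho> * d1 * (v1 * w1 + v2 * w2) + (\<tau> * B * (d2 * v1 - d1 * v2) + \<tau> * \<kappa> / 2 * \<rho>\<^sup>2 * d1 * v2) * w3
    + v3 * (\<tau> * B * (d2 * w1 - d1 * w2) + \<tau> * \<kappa> / 2 * \<rho>\<^sup>2 * d1 * w2)"
proof -
  have B0: "B \<noteq> 0" using assms by auto
  show ?thesis
  unfolding frame_def prod.case bcv_dmetric_def Let_def
  unfolding power_zero_numeral add_0_right assms(1)[symmetric]
  using B0 apply (simp add: divide_simps)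
  by (simp add: power2_eq_square power3_eq_cube algebra_simps)
qed

subsection \<open>The mean curvature of a helicoidal surface\<close>

lemma differentiable_transform_open:
  fixes f :: "real \<Rightarrow> real"
  assumes "f differentiable at u" "open I" "u \<in> I" "\<And>x. x \<in> I \<Longrightarrow> f x = g x"
  shows "g differentiable at u"
  using assms has_field_derivative_transform_within_open[of f _ u I g]
  unfolding real_differentiable_def by blast

text \<open>The antiderivatives, existentially quantified in \<open>helicoidal_surface\<close>,
  become parameters so that derivatives of \<open>\<psi>\<close> can be computed from them.\<close>

locale bcv_helicoid =
  fixes \<kappa> \<tau> m a :: real and U :: "real \<Rightarrow> real" and I :: "real set"
    and \<psi> :: "real \<Rightarrow> real \<Rightarrow> real \<times> real \<times> real" and \<xi>2 \<Theta> :: "real \<Rightarrow> real"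
  assumes m: "m \<noteq> 0"
    and reg: "hel_regular \<kappa> \<tau> U m a I"
    and \<xi>2: "u \<in> I \<Longrightarrow> (\<xi>2 has_real_derivative hel_xi2_integrand \<kappa> \<tau> U m a u) (at u)"
    and \<Theta>: "u \<in> I \<Longrightarrow> (\<Theta> has_real_derivative hel_theta_integrand \<kappa> \<tau> U m a u) (at u)"
    and \<psi>: "u \<in> I \<Longrightarrow> \<psi> u t = cylindrical (hel_xi1 \<kappa> \<tau> U m a u) (t / m + \<Theta> u) (\<xi>2 u + a * (t / m + \<Theta> u))"
    and \<psi>_in: "u \<in> I \<Longrightarrow> \<psi> u t \<in> bcv_space \<kappa>"
begin

text \<open>\<open>\<rho>\<close>, \<open>C\<close>, \<open>S\<close>, \<open>s\<close> are \<open>\<xi>\<^sub>1\<close>, \<open>cos \<sigma>\<close>, \<open>sin \<sigma>\<close>, \<open>\<surd>\<Delta>\<close>. In terms of \<open>p\<close>, the squared length \<open>m\<^sup>2 U\<^sup>2\<close> of the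
  Killing field is a quadratic polynomial and \<open>s\<close> is affine. Up to the sign of \<open>m\<close>, the unit tangent
  vector of the orbits has the components \<open>(0, \<alpha>, \<beta>)\<close> in the rotated frame.\<close>

abbreviation "\<rho> \<equiv> hel_xi1 \<kappa> \<tau> U m a"

definition B :: "real \<Rightarrow> real" where "B u = 1 + \<kappa> / 4 * (\<rho> u)\<^sup>2"
definition p :: "real \<Rightarrow> real" where "p u = (\<rho> u)\<^sup>2 / B u"
definition s :: "real \<Rightarrow> real" where "s u = sqrt (hel_Delta \<kappa> \<tau> U m a u)"
definition C :: "real \<Rightarrow> real" where "C u = deriv \<rho> u / B u"
definition S :: "real \<Rightarrow> real" where "S u = sqrt (hel_radicand \<kappa> \<tau> U m a u) / \<rho> u"
definition \<alpha> :: "real \<Rightarrow> real" where "\<alpha> u = \<rho> u / (B u * m * U u)"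
definition \<beta> :: "real \<Rightarrow> real" where "\<beta> u = (a - \<tau> * p u) / (m * U u)"

lemma open_I: "open I" and interval_I: "is_interval I" and I_nonempty: "I \<noteq> {}"
  and U_pos: "u \<in> I \<Longrightarrow> U u > 0"
  and Delta_pos: "u \<in> I \<Longrightarrow> hel_Delta \<kappa> \<tau> U m a u > 0"
  and radicand1_pos: "u \<in> I \<Longrightarrow> hel_xi1_radicand \<kappa> \<tau> U m a u > 0"
  and radicand_nonneg: "u \<in> I \<Longrightarrow> hel_radicand \<kappa> \<tau> U m a u \<ge> 0"
  using reg by (auto simp: hel_regular_def)

lemma U_differentiable: "u \<in> I \<Longrightarrow> U differentiable at u"
  and U'_differentiable: "u \<in> I \<Longrightarrow> deriv U differentiable at u"
  and sqrt_radicand_differentiable: "u \<in> I \<Longrightarrow> (\<lambda>u. sqrt (hel_radicand \<kappa> \<tau> U m a u)) differentiable at u"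
  using reg by (auto simp: hel_regular_def C1_differentiable_on_eq)

lemma U_deriv: "u \<in> I \<Longrightarrow> (U has_real_derivative deriv U u) (at u)"
  by (meson DERIV_deriv_iff_real_differentiable U_differentiable)

lemma \<rho>_pos: "u \<in> I \<Longrightarrow> \<rho> u > 0"
  using radicand1_pos by (simp add: hel_xi1_def)

lemma \<rho>_sq: "u \<in> I \<Longrightarrow> (\<rho> u)\<^sup>2 = 4 * hel_xi1_radicand \<kappa> \<tau> U m a u"
  using radicand1_pos[of u] by (simp add: hel_xi1_def power_mult_distrib)

lemma \<psi>_rot: "u \<in> I \<Longrightarrow> \<psi> u t = rot (t / m + \<Theta> u) (\<rho> u, 0, \<xi>2 u + a * (t / m + \<Theta> u))"
  by (simp add: \<psi> cylindrical_def rot_def)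

lemma B_pos: "u \<in> I \<Longrightarrow> B u > 0"
  using \<psi>_in[of u 0] by (simp add: \<psi>_rot bcv_space_rot) (simp add: bcv_space_def B_def)

lemma p_pos: "u \<in> I \<Longrightarrow> p u > 0"
  using \<rho>_pos[of u] B_pos[of u] by (simp add: p_def)

lemma s_pos: "u \<in> I \<Longrightarrow> s u > 0"
  using Delta_pos by (simp add: s_def)

lemma s_sq: "u \<in> I \<Longrightarrow> (s u)\<^sup>2 = (1 - 2 * a * \<tau>)\<^sup>2 + (m\<^sup>2 * (U u)\<^sup>2 - a\<^sup>2) * (4 * \<tau>\<^sup>2 - \<kappa>)"
  using Delta_pos[of u] by (simp add: s_def hel_Delta_def)

lemma B_p: "u \<in> I \<Longrightarrow> B u * (4 - \<kappa> * p u) = 4"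
  using B_pos[of u] by (simp add: p_def right_diff_distrib) (simp add: B_def)

lemma B_p': "4 - \<kappa> * p u = 4 / B u" if "u \<in> I"
  using B_p[OF that] B_pos[OF that] by (simp add: field_simps)

lemma \<rho>_sq_p: "u \<in> I \<Longrightarrow> (\<rho> u)\<^sup>2 = B u * p u"
  using B_pos[of u] by (simp add: p_def)

text \<open>With \<open>q = m^2 U^2 - a^2\<close>, the formula for \<Delta> turns the denominator in
  \<open>hel_xi1_radicand\<close> into \<open>2 (1 - 2 a \<tau> + s) - \<kappa> q\<close>. Passing
  from \<open>\<rho>^2\<close> to \<open>p = 4 \<rho>^2 / (4 + \<kappa> \<rho>^2)\<close> cancels
  \<open>\<kappa> q\<close> and leaves \<open>p = 2 q / (1 - 2 a \<tau> + s)\<close>.\<close>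

lemma s_denominator: "1 - 2 * a * \<tau> + s u \<noteq> 0"
  and p_eq: "p u * (1 - 2 * a * \<tau> + s u) = 2 * (m\<^sup>2 * (U u)\<^sup>2 - a\<^sup>2)" if u: "u \<in> I"
proof -
  define q where "q = m\<^sup>2 * (U u)\<^sup>2 - a\<^sup>2"
  have s2: "(s u)\<^sup>2 = (1 - 2 * a * \<tau>)\<^sup>2 + q * (4 * \<tau>\<^sup>2 - \<kappa>)"
    using s_sq[OF u] by (simp add: q_def)
  have den: "(1 + s u)\<^sup>2 - 4 * \<tau>\<^sup>2 * m\<^sup>2 * (U u)\<^sup>2 = 2 * (1 - 2 * a * \<tau> + s u) - \<kappa> * q" (is "?d = _")
    using s2 unfolding q_def by algebra
  have rad: "hel_xi1_radicand \<kappa> \<tau> U m a u = q / (2 * (1 - 2 * a * \<tau> + s u) - \<kappa> * q)"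
    unfolding den[symmetric] by (simp add: hel_xi1_radicand_def s_def q_def)
  have "q \<noteq> 0" and D0: "2 * (1 - 2 * a * \<tau> + s u) - \<kappa> * q \<noteq> 0"
    using radicand1_pos[OF u] rad by auto
  show 1: "1 - 2 * a * \<tau> + s u \<noteq> 0"
  proof
    assume 0: "1 - 2 * a * \<tau> + s u = 0"
    have "q * (4 * \<tau>\<^sup>2 - \<kappa>) = 0"
      using 0 s2 by algebra
    then have \<kappa>: "\<kappa> = 4 * \<tau>\<^sup>2"
      using \<open>q \<noteq> 0\<close> by simp
    \<comment> \<open>As \<open>\<kappa> = 4 \<tau>^2\<close>, this value is negative, or 0 for
      \<open>\<tau> = 0\<close> because \<open>1 / 0 = 0\<close>; the radicand is positive.\<close>
    have "hel_xi1_radicand \<kappa> \<tau> U m a u = - 1 / \<kappa>"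
      using \<open>q \<noteq> 0\<close> by (simp add: rad 0)
    then show False
      using radicand1_pos[OF u] by (simp add: \<kappa> field_simps)
  qed
  have "(\<rho> u)\<^sup>2 * (2 * (1 - 2 * a * \<tau> + s u) - \<kappa> * q) = 4 * q"
    unfolding \<rho>_sq[OF u] rad using D0 by simp
  then have "B u * p u * (2 * (1 - 2 * a * \<tau> + s u) - \<kappa> * q) = 4 * q"
    by (simp add: \<rho>_sq_p[OF u])
  then have "B u * (p u * (2 * (1 - 2 * a * \<tau> + s u))) = B u * (4 * q)"
    using B_p[OF u] by algebra
  then have "p u * (2 * (1 - 2 * a * \<tau> + s u)) = 4 * q"
    using B_pos[OF u] mult_left_cancel[of "B u"] by (metis less_irrefl)
  then show "p u * (1 - 2 * a * \<tau> + s u) = 2 * (m\<^sup>2 * (U u)\<^sup>2 - a\<^sup>2)"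
    unfolding q_def by algebra
qed

text \<open>By the formula for \<Delta>, the difference of squares
  \<open>s^2 - (1 - 2 a \<tau>)^2\<close> is \<open>(4 \<tau>^2 - \<kappa>) (m^2 U^2 - a^2)\<close>.
  Inserting \<open>p_eq\<close> on the right lets the nonzero factor
  \<open>1 - 2 a \<tau> + s\<close> cancel.\<close>

lemma s_eq: "s u = 1 - 2 * a * \<tau> + (4 * \<tau>\<^sup>2 - \<kappa>) * p u / 2" if u: "u \<in> I"
proof -
  have "(1 - 2 * a * \<tau> + s u) * s u =
      (1 - 2 * a * \<tau> + s u) * (1 - 2 * a * \<tau> + (4 * \<tau>\<^sup>2 - \<kappa>) * p u / 2)"
    using p_eq[OF u] s_sq[OF u] by algebra
  then show ?thesis
    using s_denominator[OF u] by simp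
qed

lemma U_eq: "m\<^sup>2 * (U u)\<^sup>2 = a\<^sup>2 + (1 - 2 * a * \<tau>) * p u + (4 * \<tau>\<^sup>2 - \<kappa>) * (p u)\<^sup>2 / 4" if u: "u \<in> I"
  using p_eq[OF u] s_eq[OF u] by algebra

section \<open>Regularity of the profile functions\<close>

lemma s_deriv: "(s has_real_derivative
    (4 * \<tau>\<^sup>2 - \<kappa>) * m\<^sup>2 * U u * deriv U u / s u) (at u)" if u: "u \<in> I"
proof -
  have "(hel_Delta \<kappa> \<tau> U m a has_real_derivative 2 * m\<^sup>2 * U u * deriv U u * (4 * \<tau>\<^sup>2 - \<kappa>)) (at u)"
    unfolding hel_Delta_def[abs_def]
    by (rule derivative_eq_intros U_deriv[OF u] refl)+ simp
  from DERIV_chain2[OF DERIV_real_sqrt[OF Delta_pos[OF u]] this]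
  have "(s has_real_derivative
      inverse (s u) / 2 * (2 * m\<^sup>2 * U u * deriv U u * (4 * \<tau>\<^sup>2 - \<kappa>))) (at u)"
    by (simp add: s_def[abs_def])
  then show ?thesis
    by (rule DERIV_cong) (use s_pos[OF u] in \<open>simp add: divide_simps algebra_simps\<close>)
qed

text \<open>This is \<open>U_eq\<close> differentiated, because
  \<open>1 - 2 a \<tau> + (4 \<tau>^2 - \<kappa>) p / 2\<close> is \<open>s\<close>. As
  differentiability of \<open>p\<close> has to be obtained too, the quotient from
  \<open>p_eq\<close> is differentiated instead.\<close>

lemma p_deriv: "(p has_real_derivative 2 * m\<^sup>2 * U u * deriv U u / s u) (at u)" if u: "u \<in> I"
proof -
  have "((\<lambda>u. 2 * (m\<^sup>2 * (U u)\<^sup>2 - a\<^sup>2) / (1 - 2 * a * \<tau> + s u)) has_real_derivative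
      2 * m\<^sup>2 * U u * deriv U u / s u) (at u)"
    apply (rule derivative_eq_intros U_deriv[OF u] s_deriv[OF u] s_denominator[OF u] refl)+
    using s_denominator[OF u] s_pos[OF u]
    apply (simp add: divide_simps)
    using s_eq[OF u] p_eq[OF u] by algebra
  then show ?thesis
  proof (rule has_field_derivative_transform_within_open[OF _ open_I u])
    fix x assume "x \<in> I"
    then show "2 * (m\<^sup>2 * (U x)\<^sup>2 - a\<^sup>2) / (1 - 2 * a * \<tau> + s x) = p x"
      using p_eq[of x] s_denominator[of x] by (simp add: field_simps)
  qed
qed

lemma p'_differentiable: "deriv p differentiable at u" if u: "u \<in> I"
proof -
  have "(\<lambda>u. 2 * m\<^sup>2 * U u * deriv U u / s u) differentiable at u"
    using U_differentiable[OF u] U'_differentiable[OF u] s_deriv[OF u] s_pos[OF u]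
    by (intro derivative_intros) (auto simp: real_differentiable_def)
  then show ?thesis
    by (rule differentiable_transform_open[OF _ open_I u])
      (simp add: p_deriv[THEN DERIV_imp_deriv])
qed

lemma p_deriv': "u \<in> I \<Longrightarrow> (p has_real_derivative deriv p u) (at u)"
  using p_deriv DERIV_imp_deriv by metis

lemma p'_deriv: "u \<in> I \<Longrightarrow> (deriv p has_real_derivative deriv (deriv p) u) (at u)"
  using p'_differentiable DERIV_deriv_iff_real_differentiable by blast

text \<open>Inverting \<open>p = \<rho>^2 / B\<close> gives
  \<open>\<rho>^2 = 4 p / (4 - \<kappa> p)\<close> with denominator \<open>4 / B\<close>, and the
  quotient rule produces \<open>p' B^2\<close>.\<close>

lemma \<rho>_deriv: "(\<rho> has_real_derivative deriv p u * (B u)\<^sup>2 / (2 * \<rho> u)) (at u)" if u: "u \<in> I"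
proof -
  have *: "4 * p x / (4 - \<kappa> * p x) = (\<rho> x)\<^sup>2" if "x \<in> I" for x
    using B_p'[OF that] by (simp add: \<rho>_sq_p[OF that])
  have ne: "4 - \<kappa> * p u \<noteq> 0"
    using B_p[OF u] by auto
  have "((\<lambda>x. 4 * p x / (4 - \<kappa> * p x)) has_real_derivative
      (4 * deriv p u * (4 - \<kappa> * p u) - 4 * p u * (0 - \<kappa> * deriv p u))
        / ((4 - \<kappa> * p u) * (4 - \<kappa> * p u))) (at u)"
    by (intro DERIV_divide DERIV_cmult DERIV_diff DERIV_const p_deriv' u ne)
  moreover have "4 * deriv p u * (4 - \<kappa> * p u) - 4 * p u * (0 - \<kappa> * deriv p u) = 16 * deriv p u"
    by (simp add: algebra_simps)
  ultimately have deriv_sq: "((\<lambda>x. 4 * p x / (4 - \<kappa> * p x)) has_real_derivative deriv p u * (B u)\<^sup>2) (at u)"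
    by (simp add: B_p'[OF u] power2_eq_square)
  have "((\<lambda>x. sqrt (4 * p x / (4 - \<kappa> * p x))) has_real_derivative deriv p u * (B u)\<^sup>2 / (2 * \<rho> u)) (at u)"
    using DERIV_chain2[OF DERIV_real_sqrt deriv_sq] \<rho>_pos[OF u] by (simp add: *[OF u] field_simps)
  then show ?thesis
  proof (rule has_field_derivative_transform_within_open[OF _ open_I u])
    fix x assume "x \<in> I"
    then show "sqrt (4 * p x / (4 - \<kappa> * p x)) = \<rho> x"
      using *[of x] \<rho>_pos[of x] by simp
  qed
qed

lemma p'_eq: "u \<in> I \<Longrightarrow> deriv p u = 2 * \<rho> u * C u / B u"
  using \<rho>_deriv[of u, THEN DERIV_imp_deriv] B_pos[of u] \<rho>_pos[of u]
  by (simp add: C_def power2_eq_square)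

lemma \<rho>_deriv': "u \<in> I \<Longrightarrow> (\<rho> has_real_derivative B u * C u) (at u)"
  using \<rho>_deriv[of u] B_pos[of u] \<rho>_pos[of u]
  by (simp add: p'_eq power2_eq_square mult.commute)

lemma B_deriv: "u \<in> I \<Longrightarrow> (B has_real_derivative \<kappa> / 2 * \<rho> u * (B u * C u)) (at u)"
  unfolding B_def[abs_def]
  by (rule derivative_eq_intros \<rho>_deriv' refl | assumption)+ (simp add: B_def)

lemma C_deriv: "(C has_real_derivative deriv C u) (at u)" if u: "u \<in> I"
proof -
  have "(\<lambda>u. deriv p u * B u / (2 * \<rho> u)) differentiable at u"
    using p'_differentiable[OF u] \<rho>_deriv'[OF u] B_deriv[OF u] \<rho>_pos[OF u]
    by (intro derivative_intros) (auto simp: real_differentiable_def)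
  moreover have "deriv p x * B x / (2 * \<rho> x) = C x" if "x \<in> I" for x
    using \<rho>_pos[OF that] B_pos[OF that] by (simp add: p'_eq[OF that])
  ultimately have "C differentiable at u"
    by (rule differentiable_transform_open[OF _ open_I u])
  then show ?thesis
    by (simp add: DERIV_deriv_iff_real_differentiable)
qed

lemma S_deriv: "(S has_real_derivative deriv S u) (at u)" if u: "u \<in> I"
proof -
  have "S differentiable at u"
    unfolding S_def[abs_def]
    using sqrt_radicand_differentiable[OF u] \<rho>_deriv'[OF u] \<rho>_pos[OF u]
    by (intro derivative_intros) (auto simp: real_differentiable_def)
  then show ?thesis
    by (simp add: DERIV_deriv_iff_real_differentiable)
qed

lemma S_nonneg: "u \<in> I \<Longrightarrow> S u \<ge> 0"
  using radicand_nonneg[of u] \<rho>_pos[of u] by (simp add: S_def)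

text \<open>Since \<open>s p' = 2 m^2 U U'\<close>, the term subtracted in
  \<open>hel_radicand\<close> equals \<open>\<rho>^2 C^2\<close>; so the square root is
  \<open>\<rho>\<close> times the sine that belongs to the cosine \<open>C\<close>.\<close>

lemma C_S: "(C u)\<^sup>2 + (S u)\<^sup>2 = 1" if u: "u \<in> I"
proof -
  have s2: "hel_Delta \<kappa> \<tau> U m a u = (s u)\<^sup>2"
    using Delta_pos[OF u] by (simp add: s_def)
  have "s u * deriv p u = 2 * m\<^sup>2 * U u * deriv U u"
    using p_deriv[OF u, THEN DERIV_imp_deriv] s_pos[OF u] by simp
  then have "s u * (\<rho> u * C u) = m\<^sup>2 * U u * deriv U u * B u"
    using B_pos[OF u] by (simp add: p'_eq[OF u] field_simps)
  then have *: "(s u)\<^sup>2 * (\<rho> u)\<^sup>2 * (C u)\<^sup>2 = m ^ 4 * (U u)\<^sup>2 * (deriv U u)\<^sup>2 * (B u)\<^sup>2"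
    by algebra
  have 4: "4 + \<kappa> * (\<rho> u)\<^sup>2 = 4 * B u"
    by (simp add: B_def)
  have "hel_radicand \<kappa> \<tau> U m a u = (\<rho> u)\<^sup>2 - m ^ 4 * (U u)\<^sup>2 * (deriv U u)\<^sup>2 * (B u)\<^sup>2 / (s u)\<^sup>2"
    unfolding hel_radicand_def s2 4 by (simp add: power_mult_distrib)
  also have "\<dots> = (\<rho> u)\<^sup>2 - (\<rho> u)\<^sup>2 * (C u)\<^sup>2"
    unfolding *[symmetric] using s_pos[OF u] by simp
  finally show ?thesis
    using \<rho>_pos[OF u] radicand_nonneg[OF u]
    by (simp add: S_def power_divide field_simps)
qed

lemma C_S_deriv: "C u * deriv C u + S u * deriv S u = 0" if u: "u \<in> I"
proof -
  have "((\<lambda>u. (C u)\<^sup>2 + (S u)\<^sup>2) has_real_derivative 2 * (C u * deriv C u + S u * deriv S u)) (at u)"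
    by (rule derivative_eq_intros C_deriv[OF u] S_deriv[OF u] refl)+ simp
  moreover have "((\<lambda>u. (C u)\<^sup>2 + (S u)\<^sup>2) has_real_derivative 0) (at u)"
    by (rule has_field_derivative_transform_within_open[OF DERIV_const open_I u])
      (simp add: C_S)
  ultimately show ?thesis
    using DERIV_unique by fastforce
qed

text \<open>The Killing field has frame components \<open>(0, \<rho> / B, a - \<tau> p)\<close>; by
  \<open>U_eq\<close> its squared length is \<open>m^2 U^2\<close>.\<close>

lemma \<alpha>_\<beta>: "(\<alpha> u)\<^sup>2 + (\<beta> u)\<^sup>2 = 1" if u: "u \<in> I"
proof -
  have "(\<rho> u / B u)\<^sup>2 + (a - \<tau> * p u)\<^sup>2 = m\<^sup>2 * (U u)\<^sup>2"
  proof -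
    have "4 * (\<rho> u / B u)\<^sup>2 = 4 * p u - \<kappa> * (p u)\<^sup>2"
    proof -
      have "4 * (\<rho> u / B u)\<^sup>2 = p u * (4 / B u)"
        using B_pos[OF u] by (simp add: power_divide \<rho>_sq_p[OF u]) (simp add: power2_eq_square)
      then show ?thesis
        unfolding B_p'[OF u, symmetric] by algebra
    qed
    then show ?thesis
      unfolding U_eq[OF u] by algebra
  qed
  moreover have "(\<alpha> u)\<^sup>2 = (\<rho> u / B u)\<^sup>2 / (m\<^sup>2 * (U u)\<^sup>2)"
      "(\<beta> u)\<^sup>2 = (a - \<tau> * p u)\<^sup>2 / (m\<^sup>2 * (U u)\<^sup>2)"
    by (simp_all add: \<alpha>_def \<beta>_def power_divide power_mult_distrib mult.assoc)
  ultimately have "(\<alpha> u)\<^sup>2 + (\<beta> u)\<^sup>2 = m\<^sup>2 * (U u)\<^sup>2 / (m\<^sup>2 * (U u)\<^sup>2)"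
    by (simp add: add_divide_distrib[symmetric])
  then show ?thesis
    using m U_pos[OF u] by simp
qed

lemma \<alpha>_deriv: "(\<alpha> has_real_derivative deriv \<alpha> u) (at u)"
  and \<beta>_deriv: "(\<beta> has_real_derivative deriv \<beta> u) (at u)" if u: "u \<in> I"
proof -
  have d: "\<rho> differentiable at u" "B differentiable at u" "p differentiable at u"
    using \<rho>_deriv'[OF u] B_deriv[OF u] p_deriv[OF u] real_differentiable_def by blast+
  have "\<alpha> differentiable at u" "\<beta> differentiable at u"
    unfolding \<alpha>_def[abs_def] \<beta>_def[abs_def]
    using B_pos[OF u] U_pos[OF u] m
    by (auto intro!: derivative_intros U_differentiable[OF u] d)
  then show "(\<alpha> has_real_derivative deriv \<alpha> u) (at u)" "(\<beta> has_real_derivative deriv \<beta> u) (at u)"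
    by (simp_all add: DERIV_deriv_iff_real_differentiable)
qed

lemma \<alpha>_\<beta>_deriv: "\<alpha> u * deriv \<alpha> u + \<beta> u * deriv \<beta> u = 0" if u: "u \<in> I"
proof -
  have "((\<lambda>u. (\<alpha> u)\<^sup>2 + (\<beta> u)\<^sup>2) has_real_derivative 2 * (\<alpha> u * deriv \<alpha> u + \<beta> u * deriv \<beta> u)) (at u)"
    by (rule derivative_eq_intros \<alpha>_deriv[OF u] \<beta>_deriv[OF u] refl)+ simp
  moreover have "((\<lambda>u. (\<alpha> u)\<^sup>2 + (\<beta> u)\<^sup>2) has_real_derivative 0) (at u)"
    by (rule has_field_derivative_transform_within_open[OF DERIV_const open_I u])
      (simp add: \<alpha>_\<beta>)
  ultimately show ?thesis
    using DERIV_unique by fastforce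
qed

text \<open>The formula \<sigma>' + (1 / \<xi>1 - \<kappa> \<xi>1 / 4) sin \<sigma> without a choice
  of the angle: for \<open>(C, S) = (cos \<sigma>, sin \<sigma>)\<close>, the expression
  \<open>C S' - S C'\<close> is \<sigma>'.\<close>

definition H0 :: "real \<Rightarrow> real" where
  "H0 u = C u * deriv S u - S u * deriv C u + (1 / \<rho> u - \<kappa> / 4 * \<rho> u) * S u"

abbreviation "\<theta> u t \<equiv> t / m + \<Theta> u"

text \<open>The plane orthogonal to the orbit direction \<open>(0, \<alpha>, \<beta>)\<close> is
  spanned by \<open>(1, 0, 0)\<close> and \<open>(0, - \<beta>, \<alpha>)\<close>. In this basis the
  u-curve has velocity \<open>(C, S)\<close>, and the normal is its quarter turn.\<close>

definition normal :: "real \<Rightarrow> real \<Rightarrow> real \<times> real \<times> real" where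
  "normal u t = rot (\<theta> u t) (frame \<tau> (\<rho> u) (B u) (- S u, - \<beta> u * C u, \<alpha> u * C u))"

section \<open>Derivatives of the immersion in the rotated frame\<close>

lemma sqrt_radicand: "u \<in> I \<Longrightarrow> sqrt (hel_radicand \<kappa> \<tau> U m a u) = S u * \<rho> u"
  using \<rho>_pos[of u] by (simp add: S_def)

text \<open>Inserting \<open>B\<close> gives
  \<open>(4 \<tau> - a \<kappa>) \<rho>^2 - 4 a = - 4 B m U \<beta>\<close>. This rate of turning
  makes the u-curves orthogonal to the orbits.\<close>

lemma \<theta>_deriv: "((\<lambda>u. \<theta> u t) has_real_derivative - B u * \<beta> u * S u / \<rho> u) (at u)" if u: "u \<in> I"
proof -
  have "hel_theta_integrand \<kappa> \<tau> U m a u = - B u * \<beta> u * S u / \<rho> u"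
    unfolding hel_theta_integrand_def sqrt_radicand[OF u] \<beta>_def p_def
    using \<rho>_pos[OF u] U_pos[OF u] m B_pos[OF u]
    by (simp add: divide_simps) (simp add: B_def power2_eq_square algebra_simps)
  then show ?thesis
    using \<Theta>[OF u] by (auto intro!: derivative_eq_intros)
qed

lemma height_deriv: "((\<lambda>u. \<xi>2 u + a * \<theta> u t) has_real_derivative (\<alpha> u - \<tau> * \<rho> u * \<beta> u) * S u) (at u)"
  if u: "u \<in> I"
proof -
  have 1: "hel_xi2_integrand \<kappa> \<tau> U m a u = m * U u * B u / \<rho> u * S u"
    unfolding hel_xi2_integrand_def sqrt_radicand[OF u]
    using \<rho>_pos[OF u]
    by (simp add: divide_simps) (simp add: B_def power2_eq_square algebra_simps)
  \<comment> \<open>After multiplication by \<open>m U \<rho>\<close> both sides are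
    \<open>m^2 U^2 B\<close>, the right one because \<open>\<alpha>^2 + \<beta>^2 = 1\<close>. The
    multiple of \<open>a\<close> is split off since it will cancel against
    \<open>a \<theta>'\<close>.\<close>
  have 2: "m * U u * B u / \<rho> u = a * (B u * \<beta> u / \<rho> u) + (\<alpha> u - \<tau> * \<rho> u * \<beta> u)"
  proof -
    have "m * U u * \<beta> u = a - \<tau> * p u" "\<alpha> u * (B u * m * U u) = \<rho> u"
      using m U_pos[OF u] B_pos[OF u] by (simp_all add: \<alpha>_def \<beta>_def)
    then have "m * U u * B u * (m * U u) = (a * (B u * \<beta> u) + (\<alpha> u - \<tau> * \<rho> u * \<beta> u) * \<rho> u) * (m * U u)"
      using \<alpha>_\<beta>[OF u] \<rho>_sq_p[OF u] by algebra
    then have "m * U u * B u = a * (B u * \<beta> u) + (\<alpha> u - \<tau> * \<rho> u * \<beta> u) * \<rho> u"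
      using m U_pos[OF u] by (metis less_irrefl mult_eq_0_iff mult_right_cancel)
    then show ?thesis
      using \<rho>_pos[OF u] by (simp add: field_simps)
  qed
  have "m * U u * B u / \<rho> u * S u + a * (- B u * \<beta> u * S u / \<rho> u) = (\<alpha> u - \<tau> * \<rho> u * \<beta> u) * S u"
    unfolding 2 by (simp add: algebra_simps)
  then show ?thesis
    using DERIV_add[OF \<xi>2[OF u] DERIV_cmult[OF \<theta>_deriv[OF u, of t], of a]] by (simp add: 1)
qed

lemma D\<^sub>u_\<psi>: "D\<^sub>u \<psi> u t = rot (\<theta> u t) (frame \<tau> (\<rho> u) (B u) (C u, - \<beta> u * S u, \<alpha> u * S u))" if u: "u \<in> I"
proof -
  have "((\<lambda>u. rot (\<theta> u t) (\<rho> u, 0, \<xi>2 u + a * \<theta> u t)) has_vector_derivative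
      rot (\<theta> u t) (frame \<tau> (\<rho> u) (B u) (C u, - \<beta> u * S u, \<alpha> u * S u))) (at u)"
    using rot_has_vector_derivative[OF \<theta>_deriv[OF u] \<rho>_deriv'[OF u] DERIV_const height_deriv[OF u], of t 0 t] \<rho>_pos[OF u]
    by (simp add: frame_def algebra_simps)
  then have "((\<lambda>u. \<psi> u t) has_vector_derivative
      rot (\<theta> u t) (frame \<tau> (\<rho> u) (B u) (C u, - \<beta> u * S u, \<alpha> u * S u))) (at u)"
    by (rule has_vector_derivative_transform_within_open[OF _ open_I u]) (simp add: \<psi>_rot)
  then show ?thesis
    unfolding D\<^sub>u_def by (rule vector_derivative_at)
qed

lemma D\<^sub>t_\<psi>: "D\<^sub>t \<psi> u t = rot (\<theta> u t) (0, \<rho> u / m, a / m)" if u: "u \<in> I"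
proof -
  have \<theta>: "((\<lambda>t. \<theta> u t) has_real_derivative 1 / m) (at t)"
    using m by (auto intro!: derivative_eq_intros)
  have z: "((\<lambda>t. \<xi>2 u + a * \<theta> u t) has_real_derivative a / m) (at t)"
    using m by (auto intro!: derivative_eq_intros)
  show ?thesis
    unfolding D\<^sub>t_def \<psi>_rot[OF u]
    using rot_has_vector_derivative[OF \<theta> DERIV_const DERIV_const z, of "\<rho> u" 0]
    by (intro vector_derivative_at) simp
qed

lemma D\<^sub>t_frame: "(0, \<rho> u / m, a / m) = frame \<tau> (\<rho> u) (B u) (0, U u * \<alpha> u, U u * \<beta> u)" if u: "u \<in> I"
  using m U_pos[OF u] B_pos[OF u] \<rho>_pos[OF u]
  by (simp add: frame_def \<alpha>_def \<beta>_def p_def field_simps power2_eq_square)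

lemma D\<^sub>t_D\<^sub>t_\<psi>: "D\<^sub>t (D\<^sub>t \<psi>) u t = rot (\<theta> u t) (- \<rho> u / m\<^sup>2, 0, 0)" if u: "u \<in> I"
proof -
  have \<theta>: "((\<lambda>t. \<theta> u t) has_real_derivative 1 / m) (at t)"
    using m by (auto intro!: derivative_eq_intros)
  show ?thesis
    unfolding D\<^sub>t_def[of "D\<^sub>t \<psi>"] D\<^sub>t_\<psi>[OF u]
    using rot_has_vector_derivative[OF \<theta> DERIV_const DERIV_const DERIV_const, of 0 "\<rho> u / m" "a / m"]
    by (intro vector_derivative_at) (simp add: power2_eq_square)
qed

lemma D\<^sub>u_D\<^sub>u_\<psi>: "D\<^sub>u (D\<^sub>u \<psi>) u t = rot (\<theta> u t)
   (frame \<tau> (\<rho> u) (B u)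
     (deriv C u + \<kappa> / 2 * \<rho> u * (C u)\<^sup>2 - B u * (\<beta> u * S u)\<^sup>2 / \<rho> u,
      - (deriv \<beta> u * S u + \<beta> u * deriv S u) - \<kappa> / 2 * \<rho> u * C u * \<beta> u * S u - B u * \<beta> u * S u * C u / \<rho> u,
      deriv \<alpha> u * S u + \<alpha> u * deriv S u + \<tau> * \<kappa> / 2 * (\<rho> u)\<^sup>2 * C u * \<beta> u * S u))" if u: "u \<in> I"
proof -
  let ?D = "rot (\<theta> u t)
   (frame \<tau> (\<rho> u) (B u)
     (deriv C u + \<kappa> / 2 * \<rho> u * (C u)\<^sup>2 - B u * (\<beta> u * S u)\<^sup>2 / \<rho> u,
      - (deriv \<beta> u * S u + \<beta> u * deriv S u) - \<kappa> / 2 * \<rho> u * C u * \<beta> u * S u - B u * \<beta> u * S u * C u / \<rho> u,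
      deriv \<alpha> u * S u + \<alpha> u * deriv S u + \<tau> * \<kappa> / 2 * (\<rho> u)\<^sup>2 * C u * \<beta> u * S u))"
  have 1: "((\<lambda>u. B u * C u) has_real_derivative \<kappa> / 2 * \<rho> u * (B u * C u) * C u + deriv C u * B u) (at u)"
    by (rule derivative_eq_intros B_deriv[OF u] C_deriv[OF u] refl)+
  have 2: "((\<lambda>u. B u * (- \<beta> u * S u)) has_real_derivative
      \<kappa> / 2 * \<rho> u * (B u * C u) * (- \<beta> u * S u) + (- deriv \<beta> u * S u + deriv S u * - \<beta> u) * B u) (at u)"
    by (rule derivative_eq_intros B_deriv[OF u] \<beta>_deriv[OF u] S_deriv[OF u] refl)+
  have 3: "((\<lambda>u. \<alpha> u * S u + \<tau> * \<rho> u * (- \<beta> u * S u)) has_real_derivative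
      deriv \<alpha> u * S u + deriv S u * \<alpha> u + (\<tau> * (B u * C u) * (- \<beta> u * S u)
      + (- deriv \<beta> u * S u + deriv S u * - \<beta> u) * (\<tau> * \<rho> u))) (at u)"
    by (rule derivative_eq_intros \<rho>_deriv'[OF u] \<alpha>_deriv[OF u] \<beta>_deriv[OF u] S_deriv[OF u] refl)+ simp
  have "((\<lambda>u. rot (\<theta> u t) (frame \<tau> (\<rho> u) (B u) (C u, - \<beta> u * S u, \<alpha> u * S u)))
      has_vector_derivative ?D) (at u)"
    unfolding frame_def prod.case
    by (rule has_vector_derivative_eq_rhs[OF rot_has_vector_derivative[OF \<theta>_deriv[OF u] 1 2 3]],
        rule arg_cong[where f = "rot _"])
      (use \<rho>_pos[OF u] in \<open>simp add: field_simps power2_eq_square\<close>)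
  then have "((\<lambda>u. D\<^sub>u \<psi> u t) has_vector_derivative ?D) (at u)"
    by (rule has_vector_derivative_transform_within_open[OF _ open_I u]) (simp add: D\<^sub>u_\<psi>)
  then show ?thesis
    unfolding D\<^sub>u_def[of "D\<^sub>u \<psi>"] by (rule vector_derivative_at)
qed

section \<open>First and second fundamental forms\<close>

lemma \<psi>_frame:
  assumes "u \<in> I"
  shows "bcv_metric \<kappa> \<tau> (\<psi> u t) (rot (\<theta> u t) (frame \<tau> (\<rho> u) (B u) (v1, v2, v3)))
     (rot (\<theta> u t) (frame \<tau> (\<rho> u) (B u) (w1, w2, w3))) = v1 * w1 + v2 * w2 + v3 * w3"
  by (simp only: \<psi>_rot[OF assms] bcv_metric_rot bcv_metric_frame[OF B_def B_pos[OF assms]])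

lemma first_form:
  assumes u: "u \<in> I"
  shows "bcv_metric \<kappa> \<tau> (\<psi> u t) (D\<^sub>u \<psi> u t) (D\<^sub>u \<psi> u t) = 1"
    and "bcv_metric \<kappa> \<tau> (\<psi> u t) (D\<^sub>u \<psi> u t) (D\<^sub>t \<psi> u t) = 0"
    and "bcv_metric \<kappa> \<tau> (\<psi> u t) (D\<^sub>t \<psi> u t) (D\<^sub>t \<psi> u t) = (U u)\<^sup>2"
  unfolding D\<^sub>u_\<psi>[OF u] D\<^sub>t_\<psi>[OF u] D\<^sub>t_frame[OF u] \<psi>_frame[OF u]
  subgoal using C_S[OF u] \<alpha>_\<beta>[OF u] by algebra
  subgoal by (simp add: algebra_simps)
  subgoal using \<alpha>_\<beta>[OF u] by algebra
  done

lemma unit_normal: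
  assumes u: "u \<in> I"
  shows "bcv_metric \<kappa> \<tau> (\<psi> u t) (normal u t) (normal u t) = 1"
    and "bcv_metric \<kappa> \<tau> (\<psi> u t) (normal u t) (D\<^sub>u \<psi> u t) = 0"
    and "bcv_metric \<kappa> \<tau> (\<psi> u t) (normal u t) (D\<^sub>t \<psi> u t) = 0"
  unfolding normal_def D\<^sub>u_\<psi>[OF u] D\<^sub>t_\<psi>[OF u] D\<^sub>t_frame[OF u] \<psi>_frame[OF u]
  subgoal using C_S[OF u] \<alpha>_\<beta>[OF u] by algebra
  subgoal using \<alpha>_\<beta>[OF u] by algebra
  subgoal by (simp add: algebra_simps)
  done

lemma christoffel_frame:
  assumes u: "u \<in> I"
  shows "christoffel (bcv_metric \<kappa> \<tau>) (\<psi> u t) (rot (\<theta> u t) (frame \<tau> (\<rho> u) (B u) (v1, v2, v3)))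
     (rot (\<theta> u t) (frame \<tau> (\<rho> u) (B u) (v1, v2, v3))) (rot (\<theta> u t) (frame \<tau> (\<rho> u) (B u) (n1, n2, n3))) =
     - \<kappa> * \<rho> u * v1 * (v1 * n1 + v2 * n2) + \<kappa> / 2 * \<rho> u * n1 * (v1\<^sup>2 + v2\<^sup>2)
     + \<tau> * \<kappa> / 2 * (\<rho> u)\<^sup>2 * v1 * v2 * n3
     + v3 * (\<tau> * B u * (v2 * n1 - v1 * n2) + \<tau> * \<kappa> / 2 * (\<rho> u)\<^sup>2 * v1 * n2)
     - v3 * (\<tau> * B u * (n2 * v1 - n1 * v2) + \<tau> * \<kappa> / 2 * (\<rho> u)\<^sup>2 * n1 * v2)"
  unfolding christoffel_bcv[OF \<psi>_in[OF u]]
  unfolding \<psi>_rot[OF u] bcv_dmetric_rot bcv_dmetric_frame[OF B_def B_pos[OF u]]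
  by (simp add: field_simps power2_eq_square)

text \<open>As the first fundamental form is \<open>du^2 + U^2 dt^2\<close>, the trace is
  \<open>L + R / U^2\<close>. The factor \<open>\<epsilon>\<close> is carried along to serve both
  orientations.\<close>

lemma mean_curvature_normal:
  assumes u: "u \<in> I" and N: "N u t = \<epsilon> *\<^sub>R normal u t"
  shows "mean_curvature (bcv_metric \<kappa> \<tau>) \<psi> N u t = \<epsilon> * H0 u"
proof -
  have N': "N u t = rot (\<theta> u t) (frame \<tau> (\<rho> u) (B u) (- \<epsilon> * S u, - \<epsilon> * \<beta> u * C u, \<epsilon> * \<alpha> u * C u))"
    by (simp add: N normal_def rot_def frame_def algebra_simps)
  have tt: "(- \<rho> u / m\<^sup>2, 0, 0) = frame \<tau> (\<rho> u) (B u) (- (U u)\<^sup>2 * (\<alpha> u)\<^sup>2 * B u / \<rho> u, 0, 0)"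
    using m U_pos[OF u] B_pos[OF u] \<rho>_pos[OF u]
    by (simp add: frame_def \<alpha>_def field_simps power2_eq_square)
  \<comment> \<open>An opaque letter for \<open>1 / \<rho>\<close> keeps the expansions polynomial;
    the product \<open>B r\<close> is resolved only at the end, by \<open>Br\<close>.\<close>
  define r where "r = 1 / \<rho> u"
  have r: "x / \<rho> u = x * r" for x
    by (simp add: r_def)
  have Br: "B u * r = r + \<kappa> / 4 * \<rho> u"
    using \<rho>_pos[OF u] by (simp add: B_def r_def field_simps power2_eq_square)
  define L R where "L = bcv_metric \<kappa> \<tau> (\<psi> u t) (D\<^sub>u (D\<^sub>u \<psi>) u t) (N u t)
      + christoffel (bcv_metric \<kappa> \<tau>) (\<psi> u t) (D\<^sub>u \<psi> u t) (D\<^sub>u \<psi> u t) (N u t)"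
    and "R = bcv_metric \<kappa> \<tau> (\<psi> u t) (D\<^sub>t (D\<^sub>t \<psi>) u t) (N u t)
      + christoffel (bcv_metric \<kappa> \<tau>) (\<psi> u t) (D\<^sub>t \<psi> u t) (D\<^sub>t \<psi> u t) (N u t)"
  \<comment> \<open>Grouped so that \<open>\<alpha>^2 + \<beta>^2\<close>, \<open>C^2 + S^2\<close>
    and \<open>\<alpha> \<alpha>' + \<beta> \<beta>'\<close> appear literally; the next step
    replaces them by 1, 1 and 0.\<close>
  have "L = \<epsilon> * (C u * deriv S u * ((\<alpha> u)\<^sup>2 + (\<beta> u)\<^sup>2) - S u * deriv C u
      + C u * S u * (\<alpha> u * deriv \<alpha> u + \<beta> u * deriv \<beta> u)
      + \<kappa> / 2 * \<rho> u * (C u)\<^sup>2 * S u * ((\<beta> u)\<^sup>2 - 1) - \<kappa> * \<rho> u * (C u)\<^sup>2 * S u * ((\<beta> u)\<^sup>2 - 1)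
      - \<kappa> / 2 * \<rho> u * S u * ((C u)\<^sup>2 + (\<beta> u)\<^sup>2 * (S u)\<^sup>2)
      + (B u * r * (\<beta> u)\<^sup>2 * S u + 2 * \<alpha> u * \<beta> u * \<tau> * B u * S u
        - \<tau> * \<kappa> / 2 * (\<rho> u)\<^sup>2 * \<alpha> u * \<beta> u * S u) * ((C u)\<^sup>2 + (S u)\<^sup>2))"
    unfolding L_def N' D\<^sub>u_D\<^sub>u_\<psi>[OF u] D\<^sub>u_\<psi>[OF u] \<psi>_frame[OF u] christoffel_frame[OF u] r
    by (simp add: algebra_simps power2_eq_square power3_eq_cube add_divide_distrib diff_divide_distrib)
  also have "\<dots> = \<epsilon> * (C u * deriv S u - S u * deriv C u
      - \<kappa> / 2 * \<rho> u * S u * ((C u)\<^sup>2 * ((\<beta> u)\<^sup>2 - 1) + (C u)\<^sup>2 + (\<beta> u)\<^sup>2 * (S u)\<^sup>2)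
      + B u * r * (\<beta> u)\<^sup>2 * S u + 2 * \<alpha> u * \<beta> u * \<tau> * B u * S u
        - \<tau> * \<kappa> / 2 * (\<rho> u)\<^sup>2 * \<alpha> u * \<beta> u * S u)"
    unfolding C_S[OF u] \<alpha>_\<beta>[OF u] C_S_deriv[OF u] \<alpha>_\<beta>_deriv[OF u]
    by (simp add: algebra_simps add_divide_distrib diff_divide_distrib)
  also have "(C u)\<^sup>2 * ((\<beta> u)\<^sup>2 - 1) + (C u)\<^sup>2 + (\<beta> u)\<^sup>2 * (S u)\<^sup>2 = (\<beta> u)\<^sup>2"
    using C_S[OF u] by algebra
  finally have L: "L = \<epsilon> * (C u * deriv S u - S u * deriv C u - \<kappa> / 2 * \<rho> u * S u * (\<beta> u)\<^sup>2
      + B u * r * (\<beta> u)\<^sup>2 * S u + 2 * \<alpha> u * \<beta> u * \<tau> * B u * S u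
        - \<tau> * \<kappa> / 2 * (\<rho> u)\<^sup>2 * \<alpha> u * \<beta> u * S u)" .
  define K where "K = \<epsilon> * (B u * r * (\<alpha> u)\<^sup>2 * S u - \<kappa> / 2 * \<rho> u * S u * (\<alpha> u)\<^sup>2
      - 2 * \<alpha> u * \<beta> u * \<tau> * B u * S u + \<tau> * \<kappa> / 2 * (\<rho> u)\<^sup>2 * \<alpha> u * \<beta> u * S u)"
  have "R = (U u)\<^sup>2 * K"
    unfolding R_def N' D\<^sub>t_D\<^sub>t_\<psi>[OF u] D\<^sub>t_\<psi>[OF u] D\<^sub>t_frame[OF u] tt \<psi>_frame[OF u] christoffel_frame[OF u] r K_def
    by (simp add: algebra_simps power2_eq_square add_divide_distrib diff_divide_distrib)
  then have R: "R / (U u)\<^sup>2 = K"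
    using U_pos[OF u] by simp
  \<comment> \<open>The terms with \<open>\<tau>\<close> occur with opposite signs in
    \<open>L\<close> and \<open>K\<close> and cancel. The remaining ones carry
    \<open>\<beta>^2\<close> in \<open>L\<close> and \<open>\<alpha>^2\<close> in \<open>K\<close>
    and add up.\<close>
  have "L + R / (U u)\<^sup>2 = \<epsilon> * (C u * deriv S u - S u * deriv C u
      + (B u * r - \<kappa> / 2 * \<rho> u) * S u * ((\<alpha> u)\<^sup>2 + (\<beta> u)\<^sup>2))"
    unfolding L R K_def by (simp add: algebra_simps)
  also have "\<dots> = \<epsilon> * H0 u"
    unfolding Br \<alpha>_\<beta>[OF u] H0_def r by (simp add: algebra_simps)
  finally have "L + R / (U u)\<^sup>2 = \<epsilon> * H0 u" .
  moreover have "mean_curvature (bcv_metric \<kappa> \<tau>) \<psi> N u t = L + R / (U u)\<^sup>2"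
    unfolding mean_curvature_def Let_def first_form[OF u] L_def[symmetric] R_def[symmetric]
    using U_pos[OF u] by (simp add: field_simps)
  ultimately show ?thesis by simp
qed

end

subsection \<open>Reduction to a linear differential equation\<close>

lemma zero_derivative_constant:
  fixes f :: "real \<Rightarrow> real"
  assumes "connected I" "open I" "\<And>u. u \<in> I \<Longrightarrow> (f has_real_derivative 0) (at u)"
  obtains c where "\<And>u. u \<in> I \<Longrightarrow> f u = c"
proof -
  have "continuous_on I f"
    using assms(3) by (meson DERIV_isCont continuous_at_imp_continuous_on)
  then show thesis
    using DERIV_zero_connected_constant[OF assms(1,2) finite.emptyI] assms(3) that
    by (metis Diff_empty)
qed

lemma DERIV_open_local_min:
  fixes f :: "real \<Rightarrow> real"
  assumes "(f has_real_derivative l) (at u)" "open I" "u \<in> I" "\<And>x. x \<in> I \<Longrightarrow> f u \<le> f x"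
  shows "l = 0"
proof -
  obtain d where "d > 0" "\<And>y. dist y u < d \<Longrightarrow> y \<in> I"
    using assms(2,3) unfolding open_dist by blast
  then show ?thesis
    using assms(4) by (intro DERIV_local_min[OF assms(1)]) (auto simp: dist_real_def abs_minus_commute)
qed

text \<open>A continuous function with finitely many values on a connected set is constant. This
  fixes the orientation of a normal field as well as the sign of \<open>H\<close>.\<close>

lemma square_one_constant_sign:
  fixes f :: "'a::topological_space \<Rightarrow> real"
  assumes "connected A" "A \<noteq> {}" "continuous_on A f" "\<And>x. x \<in> A \<Longrightarrow> (f x)\<^sup>2 = 1"
  obtains \<epsilon> where "\<epsilon> \<in> {1, -1}" "\<And>x. x \<in> A \<Longrightarrow> f x = \<epsilon>"
proof -
  have range: "f ` A \<subseteq> {1, -1}"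
    using assms(4) by (auto simp: power2_eq_1_iff)
  then have "f constant_on A"
    using assms(1,3) continuous_finite_range_constant finite_subset by (metis finite.emptyI finite.insertI)
  then obtain c where c: "\<And>x. x \<in> A \<Longrightarrow> f x = c"
    unfolding constant_on_def by blast
  moreover have "c \<in> {1, -1}"
    using assms(2) range c by (metis ex_in_conv image_subset_iff)
  ultimately show thesis
    using that by blast
qed

section \<open>Orientation: an arbitrary unit normal field against \<open>normal\<close>\<close>

context bcv_helicoid begin

text \<open>The inverse of \<open>rot\<close> after \<open>frame\<close>, with explicit components
  so that they inherit continuity from a normal field.\<close>

lemma frame_coordinates:
  assumes u: "u \<in> I"
    and n1: "n1 = (fst v * cos x + fst (snd v) * sin x) / B u"
    and n2: "n2 = (fst (snd v) * cos x - fst v * sin x) / B u"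
    and n3: "n3 = snd (snd v) - \<tau> * \<rho> u * n2"
  shows "v = rot x (frame \<tau> (\<rho> u) (B u) (n1, n2, n3))"
proof -
  obtain v1 v2 v3 where v: "v = (v1, v2, v3)" by (cases v)
  have B: "B u * n1 = v1 * cos x + v2 * sin x" "B u * n2 = v2 * cos x - v1 * sin x"
    using B_pos[OF u] by (simp_all add: n1 n2 v)
  have "(v1 * cos x + v2 * sin x) * cos x - (v2 * cos x - v1 * sin x) * sin x = v1"
    "(v1 * cos x + v2 * sin x) * sin x + (v2 * cos x - v1 * sin x) * cos x = v2"
    using sin_cos_squared_add[of x] by algebra+
  then show ?thesis
    by (simp add: rot_def frame_def B) (simp add: v n3)
qed

text \<open>Orthogonality to the orbit leaves the plane of \<open>(1, 0, 0)\<close> and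
  \<open>(0, - \<beta>, \<alpha>)\<close>, with \<open>d\<close> the second coordinate; there,
  orthogonality to \<open>(C, S)\<close> and length 1 leave two vectors.\<close>

lemma unit_normal_unique:
  assumes u: "u \<in> I"
    and n: "n1\<^sup>2 + n2\<^sup>2 + n3\<^sup>2 = 1" "C u * n1 - \<beta> u * S u * n2 + \<alpha> u * S u * n3 = 0"
      "\<alpha> u * n2 + \<beta> u * n3 = 0"
    and \<epsilon>: "\<epsilon> = - S u * n1 - \<beta> u * C u * n2 + \<alpha> u * C u * n3"
  shows "\<epsilon>\<^sup>2 = 1" "n1 = - \<epsilon> * S u" "n2 = - \<epsilon> * \<beta> u * C u" "n3 = \<epsilon> * \<alpha> u * C u"
proof -
  define d where "d = - \<beta> u * n2 + \<alpha> u * n3"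
  have "n2 = - \<beta> u * d" "n3 = \<alpha> u * d"
    using n(3) \<alpha>_\<beta>[OF u] unfolding d_def by algebra+
  moreover have "C u * n1 + S u * d = 0" "\<epsilon> = - S u * n1 + C u * d"
    using n(2) unfolding d_def \<epsilon> by (simp_all add: algebra_simps)
  then have "n1 = - \<epsilon> * S u" "d = \<epsilon> * C u"
    using C_S[OF u] by algebra+
  ultimately show n': "n1 = - \<epsilon> * S u" "n2 = - \<epsilon> * \<beta> u * C u" "n3 = \<epsilon> * \<alpha> u * C u"
    by simp_all
  have "\<epsilon>\<^sup>2 * (((\<alpha> u)\<^sup>2 + (\<beta> u)\<^sup>2) * (C u)\<^sup>2 + (S u)\<^sup>2) = 1"
    using n(1) unfolding n' by algebra
  then show "\<epsilon>\<^sup>2 = 1"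
    by (simp add: \<alpha>_\<beta>[OF u] C_S[OF u])
qed

lemma continuous_on_I:
  "continuous_on I \<rho>" "continuous_on I B" "continuous_on I C" "continuous_on I S"
  "continuous_on I \<alpha>" "continuous_on I \<beta>" "continuous_on I \<Theta>"
  using \<rho>_deriv' B_deriv C_deriv S_deriv \<alpha>_deriv \<beta>_deriv \<Theta>
  by (meson DERIV_isCont continuous_at_imp_continuous_on)+

lemmas continuous_on_fst = continuous_on_I[THEN continuous_on_compose2, OF continuous_on_fst[OF continuous_on_id]]

lemma connected_I: "connected I"
  using interval_I is_interval_connected by blast

text \<open>A unit normal field is \<open>e\<close> times \<open>normal\<close> with
  \<open>e^2 = 1\<close>, and \<open>e\<close> is continuous on a connected domain, so one sign
  holds globally.\<close>

lemma has_cmc_iff: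
  "has_constant_mean_curvature (bcv_metric \<kappa> \<tau>) (I \<times> UNIV) \<psi> H \<longleftrightarrow>
    (\<exists>\<epsilon>\<in>{1, -1}. \<forall>u\<in>I. H0 u = \<epsilon> * H)"
proof
  assume "has_constant_mean_curvature (bcv_metric \<kappa> \<tau>) (I \<times> UNIV) \<psi> H"
  then obtain N where cont: "continuous_on (I \<times> UNIV) (\<lambda>(u, t). N u t)"
    and N: "\<And>u t. u \<in> I \<Longrightarrow> bcv_metric \<kappa> \<tau> (\<psi> u t) (N u t) (N u t) = 1"
      "\<And>u t. u \<in> I \<Longrightarrow> bcv_metric \<kappa> \<tau> (\<psi> u t) (N u t) (D\<^sub>u \<psi> u t) = 0"
      "\<And>u t. u \<in> I \<Longrightarrow> bcv_metric \<kappa> \<tau> (\<psi> u t) (N u t) (D\<^sub>t \<psi> u t) = 0"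
    and H: "\<And>u t. u \<in> I \<Longrightarrow> mean_curvature (bcv_metric \<kappa> \<tau>) \<psi> N u t = H"
    unfolding has_constant_mean_curvature_def unit_normal_field_def by auto
  define n1 where "n1 = (\<lambda>(u, t). (fst (N u t) * cos (\<theta> u t) + fst (snd (N u t)) * sin (\<theta> u t)) / B u)"
  define n2 where "n2 = (\<lambda>(u, t). (fst (snd (N u t)) * cos (\<theta> u t) - fst (N u t) * sin (\<theta> u t)) / B u)"
  define n3 where "n3 = (\<lambda>(u, t). snd (snd (N u t)) - \<tau> * \<rho> u * n2 (u, t))"
  define e where "e = (\<lambda>(u, t). - S u * n1 (u, t) - \<beta> u * C u * n2 (u, t) + \<alpha> u * C u * n3 (u, t))"
  have coords: "N u t = rot (\<theta> u t) (frame \<tau> (\<rho> u) (B u) (n1 (u, t), n2 (u, t), n3 (u, t)))" if "u \<in> I" for u t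
    by (rule frame_coordinates[OF that]) (simp_all add: n1_def n2_def n3_def)
  have e: "(e (u, t))\<^sup>2 = 1" "N u t = e (u, t) *\<^sub>R normal u t" if u: "u \<in> I" for u t
  proof -
    have n: "(n1 (u, t))\<^sup>2 + (n2 (u, t))\<^sup>2 + (n3 (u, t))\<^sup>2 = 1"
      "C u * n1 (u, t) - \<beta> u * S u * n2 (u, t) + \<alpha> u * S u * n3 (u, t) = 0"
      using N(1,2)[OF u, of t] unfolding coords[OF u] D\<^sub>u_\<psi>[OF u] \<psi>_frame[OF u]
      by (simp_all add: power2_eq_square algebra_simps)
    have "U u * (\<alpha> u * n2 (u, t) + \<beta> u * n3 (u, t)) = 0"
      using N(3)[OF u, of t] unfolding coords[OF u] D\<^sub>t_\<psi>[OF u] D\<^sub>t_frame[OF u] \<psi>_frame[OF u]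
      by (simp add: algebra_simps)
    then have n0: "\<alpha> u * n2 (u, t) + \<beta> u * n3 (u, t) = 0"
      using U_pos[OF u] by simp
    have "e (u, t) = - S u * n1 (u, t) - \<beta> u * C u * n2 (u, t) + \<alpha> u * C u * n3 (u, t)"
      by (simp add: e_def)
    note * = unit_normal_unique[OF u n n0 this]
    show "(e (u, t))\<^sup>2 = 1" by (fact *)
    show "N u t = e (u, t) *\<^sub>R normal u t"
      unfolding coords[OF u] normal_def *(2-4) by (simp add: rot_def frame_def algebra_simps)
  qed
  have cont': "continuous_on (I \<times> UNIV) (\<lambda>x. N (fst x) (snd x))"
    using cont by (simp add: case_prod_beta)
  have "continuous_on (I \<times> UNIV) e"
    unfolding e_def n3_def n1_def n2_def case_prod_beta fst_conv snd_conv
    using m by (intro continuous_intros cont' continuous_on_fst) (auto dest: B_pos)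
  moreover have "connected (I \<times> (UNIV :: real set))"
    by (intro connected_Times connected_I connected_UNIV)
  ultimately obtain \<epsilon> where \<epsilon>: "\<epsilon> \<in> {1, -1}" "\<And>x. x \<in> I \<times> UNIV \<Longrightarrow> e x = \<epsilon>"
    using square_one_constant_sign[of "I \<times> UNIV" e] I_nonempty e(1) by auto
  have "H0 u = \<epsilon> * H" if "u \<in> I" for u
    using mean_curvature_normal[where N = N and t = 0, OF that e(2)[OF that]] H[OF that, of 0] \<epsilon>(2)[of "(u, 0)"] \<epsilon>(1) that
    by auto
  then show "\<exists>\<epsilon>\<in>{1, -1}. \<forall>u\<in>I. H0 u = \<epsilon> * H"
    using \<epsilon>(1) by blast
next
  assume "\<exists>\<epsilon>\<in>{1, -1}. \<forall>u\<in>I. H0 u = \<epsilon> * H"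
  then obtain \<epsilon> where \<epsilon>: "\<epsilon> = 1 \<or> \<epsilon> = -1" "\<And>u. u \<in> I \<Longrightarrow> H0 u = \<epsilon> * H" by blast
  define N where "N u t = \<epsilon> *\<^sub>R normal u t" for u t
  have N': "N u t = rot (\<theta> u t) (frame \<tau> (\<rho> u) (B u) (- \<epsilon> * S u, - \<epsilon> * \<beta> u * C u, \<epsilon> * \<alpha> u * C u))" for u t
    by (simp add: N_def normal_def rot_def frame_def algebra_simps)
  have "continuous_on (I \<times> UNIV) (\<lambda>(u, t). N u t)"
    unfolding N_def normal_def rot_def frame_def case_prod_beta fst_conv snd_conv
    using m by (intro continuous_intros continuous_on_fst) auto
  moreover have "bcv_metric \<kappa> \<tau> (\<psi> u t) (N u t) (N u t) = 1 \<and>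
      bcv_metric \<kappa> \<tau> (\<psi> u t) (N u t) (D\<^sub>u \<psi> u t) = 0 \<and>
      bcv_metric \<kappa> \<tau> (\<psi> u t) (N u t) (D\<^sub>t \<psi> u t) = 0" if "u \<in> I" for u t
    using unit_normal[OF that, of t] \<epsilon>(1)
    unfolding normal_def N' D\<^sub>u_\<psi>[OF that] D\<^sub>t_\<psi>[OF that] D\<^sub>t_frame[OF that] \<psi>_frame[OF that]
    by auto
  moreover have "mean_curvature (bcv_metric \<kappa> \<tau>) \<psi> N u t = H" if "u \<in> I" for u t
    using mean_curvature_normal[OF that, of N t \<epsilon>] \<epsilon> that by (auto simp: N_def)
  ultimately show "has_constant_mean_curvature (bcv_metric \<kappa> \<tau>) (I \<times> UNIV) \<psi> H"
    unfolding has_constant_mean_curvature_def unit_normal_field_def by (intro exI[of _ N]) auto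
qed

text \<open>\<open>W\<close> is the quantity in the first integral: for constant \<open>H0\<close>, \<open>W - H0 p / 2\<close> is constant.\<close>

definition W :: "real \<Rightarrow> real" where "W u = \<rho> u * S u / B u"

lemma W_nonneg: "u \<in> I \<Longrightarrow> W u \<ge> 0"
  using \<rho>_pos[of u] B_pos[of u] S_nonneg[of u] by (simp add: W_def)

lemma p'_sq: "(deriv p u)\<^sup>2 = 4 * p u - \<kappa> * (p u)\<^sup>2 - 4 * (W u)\<^sup>2" if u: "u \<in> I"
proof -
  have "(deriv p u)\<^sup>2 = 4 * ((\<rho> u / B u)\<^sup>2 - (W u)\<^sup>2)"
  proof -
    have "(C u)\<^sup>2 = 1 - (S u)\<^sup>2" using C_S[OF u] by simp
    then show ?thesis
      unfolding p'_eq[OF u] W_def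
      by (simp add: power_divide power_mult_distrib right_diff_distrib diff_divide_distrib)
  qed
  moreover have "4 * (\<rho> u / B u)\<^sup>2 = p u * (4 / B u)"
    using B_pos[OF u] by (simp add: power_divide \<rho>_sq_p[OF u]) (simp add: power2_eq_square)
  ultimately show ?thesis
    unfolding B_p'[OF u, symmetric] by (simp add: power2_eq_square algebra_simps)
qed

lemma B_double: "\<kappa> * (\<rho> u)\<^sup>2 = 4 * B u - 4"
  by (simp add: B_def)

lemma H0_\<rho>: "H0 u * \<rho> u = \<rho> u * (C u * deriv S u - S u * deriv C u) + (2 - B u) * S u" if "u \<in> I"
  using \<rho>_pos[OF that] by (simp add: H0_def B_def field_simps power2_eq_square)

lemma W_deriv: "(W has_real_derivative H0 u * deriv p u / 2) (at u)" if u: "u \<in> I"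
proof -
  have "(W has_real_derivative ((B u * C u * S u + deriv S u * \<rho> u) * B u
      - \<rho> u * S u * (\<kappa> / 2 * \<rho> u * (B u * C u))) / (B u * B u)) (at u)"
    unfolding W_def[abs_def] using B_pos[OF u]
    by (intro DERIV_divide DERIV_mult \<rho>_deriv' B_deriv S_deriv u) simp
  moreover have "((B u * C u * S u + deriv S u * \<rho> u) * B u
      - \<rho> u * S u * (\<kappa> / 2 * \<rho> u * (B u * C u))) / (B u * B u) = H0 u * deriv p u / 2"
  proof -
    \<comment> \<open>The rule (sin \<sigma>)' = \<sigma>' cos \<sigma> in the form
      \<open>C (C S' - S C') = S'\<close>, from \<open>C^2 + S^2 = 1\<close> and its
      derivative.\<close>
    have "H0 u * \<rho> u * C u = B u * C u * S u + deriv S u * \<rho> u - \<kappa> / 2 * (\<rho> u)\<^sup>2 * C u * S u"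
      using H0_\<rho>[OF u] C_S[OF u] C_S_deriv[OF u] B_double[of u] by algebra
    moreover have "((B u * C u * S u + deriv S u * \<rho> u) * B u
      - \<rho> u * S u * (\<kappa> / 2 * \<rho> u * (B u * C u))) / (B u * B u) =
      (B u * C u * S u + deriv S u * \<rho> u - \<kappa> / 2 * (\<rho> u)\<^sup>2 * C u * S u) / B u"
      using B_pos[OF u] by (simp add: divide_simps) (simp add: algebra_simps power2_eq_square)
    ultimately show ?thesis
      by (simp add: p'_eq[OF u])
  qed
  ultimately show ?thesis by (rule DERIV_cong)
qed

lemma p'': "deriv (deriv p) u = 2 - \<kappa> * p u - 2 * H0 u * W u" if u: "u \<in> I"
proof -
  have "((\<lambda>u. 2 * \<rho> u * C u / B u) has_real_derivative ((2 * (B u * C u) * C u + deriv C u * (2 * \<rho> u)) * B u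
      - 2 * \<rho> u * C u * (\<kappa> / 2 * \<rho> u * (B u * C u))) / (B u * B u)) (at u)"
    using B_pos[OF u]
    by (intro DERIV_divide DERIV_mult DERIV_cmult \<rho>_deriv' B_deriv C_deriv u) simp
  then have "(deriv p has_real_derivative ((2 * (B u * C u) * C u + deriv C u * (2 * \<rho> u)) * B u
      - 2 * \<rho> u * C u * (\<kappa> / 2 * \<rho> u * (B u * C u))) / (B u * B u)) (at u)"
    by (rule has_field_derivative_transform_within_open[OF _ open_I u]) (simp add: p'_eq)
  moreover have "((2 * (B u * C u) * C u + deriv C u * (2 * \<rho> u)) * B u
      - 2 * \<rho> u * C u * (\<kappa> / 2 * \<rho> u * (B u * C u))) / (B u * B u) = 2 - \<kappa> * p u - 2 * H0 u * W u"
  proof -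
    \<comment> \<open>The companion (cos \<sigma>)' = - \<sigma>' sin \<sigma>, that is
      \<open>S (C S' - S C') = - C'\<close>.\<close>
    have "2 * H0 u * \<rho> u * S u = 2 * B u - \<kappa> * (\<rho> u)\<^sup>2 - 2 * B u * (C u)\<^sup>2 - 2 * \<rho> u * deriv C u + \<kappa> * (\<rho> u)\<^sup>2 * (C u)\<^sup>2"
      using H0_\<rho>[OF u] C_S[OF u] C_S_deriv[OF u] B_double[of u] by algebra
    moreover have "((2 * (B u * C u) * C u + deriv C u * (2 * \<rho> u)) * B u
      - 2 * \<rho> u * C u * (\<kappa> / 2 * \<rho> u * (B u * C u))) / (B u * B u) =
      (2 * B u * (C u)\<^sup>2 + 2 * \<rho> u * deriv C u - \<kappa> * (\<rho> u)\<^sup>2 * (C u)\<^sup>2) / B u"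
      using B_pos[OF u] by (simp add: divide_simps) (simp add: algebra_simps power2_eq_square)
    moreover have "2 - \<kappa> * p u - 2 * H0 u * W u = (2 * B u - \<kappa> * (\<rho> u)\<^sup>2 - 2 * H0 u * \<rho> u * S u) / B u"
      unfolding p_def W_def using B_pos[OF u] by (simp add: field_simps)
    ultimately show ?thesis by simp
  qed
  ultimately show ?thesis
    using DERIV_imp_deriv by metis
qed

text \<open>In the converse, \<open>f = H p / 2 + k\<close> satisfies \<open>W^2 = f^2\<close> and
  \<open>H0 W = H f\<close>, so \<open>f / W\<close> is the wanted sign where \<open>W\<close> is
  nonzero. For \<open>H \<noteq> 0\<close> this is everywhere; for \<open>H = 0\<close> it remains
  to see that \<open>H0\<close> vanishes at the zeros of \<open>W\<close> too.\<close>

lemma cmc_iff_ode: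
  "(\<exists>\<epsilon>\<in>{1, -1}. \<forall>u\<in>I. H0 u = \<epsilon> * H) \<longleftrightarrow>
    (\<exists>k. \<forall>u\<in>I. deriv (deriv p) u = (2 - 2 * H * k) - (H\<^sup>2 + \<kappa>) * p u \<and>
      (deriv p u)\<^sup>2 = - 4 * k\<^sup>2 + 2 * (2 - 2 * H * k) * p u - (H\<^sup>2 + \<kappa>) * (p u)\<^sup>2)"
proof
  assume "\<exists>\<epsilon>\<in>{1, -1}. \<forall>u\<in>I. H0 u = \<epsilon> * H"
  then obtain \<epsilon> where \<epsilon>': "\<epsilon> \<in> {1, -1}" and \<epsilon>: "\<And>u. u \<in> I \<Longrightarrow> H0 u = \<epsilon> * H" by blast
  have \<epsilon>: "\<epsilon>\<^sup>2 = 1" "\<And>u. u \<in> I \<Longrightarrow> H0 u = \<epsilon> * H"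
    using \<epsilon>' \<epsilon> by auto
  obtain k where k: "\<epsilon> * W u - H * p u / 2 = k" if "u \<in> I" for u
  proof -
    have "((\<lambda>u. \<epsilon> * W u - H * p u / 2) has_real_derivative 0) (at u)" if "u \<in> I" for u
    proof -
      have "((\<lambda>u. \<epsilon> * W u - H * p u / 2) has_real_derivative \<epsilon> * (H0 u * deriv p u / 2) - H * deriv p u / 2) (at u)"
        by (intro DERIV_diff DERIV_cmult DERIV_cdivide W_deriv p_deriv' that)
      moreover have "\<epsilon> * (H0 u * deriv p u / 2) - H * deriv p u / 2 = 0"
        unfolding \<epsilon>(2)[OF that] using \<epsilon>(1) by (simp add: power2_eq_square flip: mult.assoc)
      ultimately show ?thesis by metis
    qed
    from zero_derivative_constant[OF connected_I open_I this] that show thesis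
      by blast
  qed
  have "deriv (deriv p) u = (2 - 2 * H * k) - (H\<^sup>2 + \<kappa>) * p u \<and>
      (deriv p u)\<^sup>2 = - 4 * k\<^sup>2 + 2 * (2 - 2 * H * k) * p u - (H\<^sup>2 + \<kappa>) * (p u)\<^sup>2" if u: "u \<in> I" for u
    unfolding p''[OF u] p'_sq[OF u] k[OF u, symmetric] \<epsilon>(2)[OF u]
    using \<epsilon>(1) by (simp add: power2_eq_square algebra_simps)
  then show "\<exists>k. \<forall>u\<in>I. deriv (deriv p) u = (2 - 2 * H * k) - (H\<^sup>2 + \<kappa>) * p u \<and>
      (deriv p u)\<^sup>2 = - 4 * k\<^sup>2 + 2 * (2 - 2 * H * k) * p u - (H\<^sup>2 + \<kappa>) * (p u)\<^sup>2" by blast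
next
  assume "\<exists>k. \<forall>u\<in>I. deriv (deriv p) u = (2 - 2 * H * k) - (H\<^sup>2 + \<kappa>) * p u \<and>
      (deriv p u)\<^sup>2 = - 4 * k\<^sup>2 + 2 * (2 - 2 * H * k) * p u - (H\<^sup>2 + \<kappa>) * (p u)\<^sup>2"
  then obtain k where k: "\<And>u. u \<in> I \<Longrightarrow> deriv (deriv p) u = (2 - 2 * H * k) - (H\<^sup>2 + \<kappa>) * p u"
      "\<And>u. u \<in> I \<Longrightarrow> (deriv p u)\<^sup>2 = - 4 * k\<^sup>2 + 2 * (2 - 2 * H * k) * p u - (H\<^sup>2 + \<kappa>) * (p u)\<^sup>2"
    by blast
  define f where "f u = H * p u / 2 + k" for u
  have f: "(f has_real_derivative H * deriv p u / 2) (at u)" if "u \<in> I" for u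
    unfolding f_def[abs_def] by (auto intro!: derivative_eq_intros p_deriv' that)
  have f_sq: "(W u)\<^sup>2 = (f u)\<^sup>2" if u: "u \<in> I" for u
    using k(2)[OF u] unfolding p'_sq[OF u] f_def by (simp add: field_simps power2_eq_square)
  have WH: "H0 u * W u = H * f u" if u: "u \<in> I" for u
    using k(1)[OF u] unfolding p''[OF u] f_def by (simp add: field_simps power2_eq_square)
  have p'0: "deriv p u \<noteq> 0" if u: "u \<in> I" and "W u = 0" for u
  proof -
    have "S u = 0" using \<rho>_pos[OF u] B_pos[OF u] that(2) by (simp add: W_def)
    then have "C u \<noteq> 0" using C_S[OF u] by auto
    then show ?thesis using \<rho>_pos[OF u] B_pos[OF u] by (simp add: p'_eq[OF u])
  qed
  have H00: "H0 u = 0" and H0: "H = 0" if u: "u \<in> I" and W0: "W u = 0" for u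
  proof -
    have f0: "f u = 0" using f_sq[OF u] W0 by simp
    \<comment> \<open>The nonnegative function \<open>W\<close> has a minimum at its zero
      \<open>u\<close>. There \<open>p'\<close> is nonzero, so the other factor of \<open>W'\<close>
      must vanish.\<close>
    have "H0 u * deriv p u / 2 = 0"
      by (rule DERIV_open_local_min[OF W_deriv[OF u] open_I u]) (use W0 W_nonneg in auto)
    then show "H0 u = 0" using p'0[OF u W0] by simp
    \<comment> \<open>\<open>W = \<bar>f\<bar>\<close>, which is not differentiable at a simple zero of \<open>f\<close>.\<close>
    have "H0 u * deriv p u / 2 - H * deriv p u / 2 = 0"
    proof (rule DERIV_open_local_min[OF DERIV_diff[OF W_deriv[OF u] f[OF u]] open_I u])
      fix x assume "x \<in> I"
      then show "W u - f u \<le> W x - f x"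
        using f_sq[of x] W_nonneg[of x] W0 f0 power2_le_imp_le[of "f x" "W x"] by simp
    qed
    then show "H = 0" using \<open>H0 u = 0\<close> p'0[OF u W0] by simp
  qed
  show "\<exists>\<epsilon>\<in>{1, -1}. \<forall>u\<in>I. H0 u = \<epsilon> * H"
  proof (cases "H = 0")
    case True
    then have "H0 u = 0" if "u \<in> I" for u
      using WH[OF that] H00[OF that] by auto
    then show ?thesis using True by (intro bexI[of _ 1]) auto
  next
    case False
    then have W0: "W u \<noteq> 0" if "u \<in> I" for u using H0[OF that] by blast
    have "continuous_on I W" "continuous_on I f"
      using W_deriv f by (meson DERIV_isCont continuous_at_imp_continuous_on)+
    then have fW: "continuous_on I (\<lambda>u. f u / W u)"
      using W0 by (intro continuous_intros) auto
    have "(f u / W u)\<^sup>2 = 1" if "u \<in> I" for u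
      using W0[OF that] by (simp add: power_divide flip: f_sq[OF that])
    then obtain \<epsilon> where \<epsilon>: "\<epsilon> \<in> {1, -1}" "\<And>u. u \<in> I \<Longrightarrow> f u / W u = \<epsilon>"
      using square_one_constant_sign[OF connected_I I_nonempty fW] by blast
    have "H0 u = \<epsilon> * H" if "u \<in> I" for u
      using WH[OF that] \<epsilon>(2)[OF that] W0[OF that] by (simp add: field_simps)
    then show ?thesis using \<epsilon>(1) by blast
  qed
qed

end

subsection \<open>Solution of the differential equation\<close>

text \<open>For nonconstant \<open>X\<close> the last equation, a first integral of the linear one, would suffice. At
  constant \<open>X\<close> only the linear equation excludes the singular solutions.\<close>

definition quadratic_ode :: "real set \<Rightarrow> real \<Rightarrow> real \<Rightarrow> real \<Rightarrow> (real \<Rightarrow> real) \<Rightarrow> bool" where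
  "quadratic_ode I b b1 \<omega> X \<longleftrightarrow> (\<exists>D. \<forall>u\<in>I.
     (X has_real_derivative D u) (at u) \<and>
     (D has_real_derivative b1 - \<omega> * X u) (at u) \<and>
     (D u)\<^sup>2 = b + 2 * b1 * X u - \<omega> * (X u)\<^sup>2)"

lemma quadratic_odeI:
  assumes "\<And>u. u \<in> I \<Longrightarrow> (X has_real_derivative D u) (at u)"
    "\<And>u. u \<in> I \<Longrightarrow> (D has_real_derivative b1 - \<omega> * X u) (at u)"
    "\<And>u. u \<in> I \<Longrightarrow> (D u)\<^sup>2 = b + 2 * b1 * X u - \<omega> * (X u)\<^sup>2"
  shows "quadratic_ode I b b1 \<omega> X"
  using assms unfolding quadratic_ode_def by blast

lemma quadratic_odeE:
  assumes "quadratic_ode I b b1 \<omega> X"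
  obtains D where "\<And>u. u \<in> I \<Longrightarrow> (X has_real_derivative D u) (at u)"
    "\<And>u. u \<in> I \<Longrightarrow> (D has_real_derivative b1 - \<omega> * X u) (at u)"
    "\<And>u. u \<in> I \<Longrightarrow> (D u)\<^sup>2 = b + 2 * b1 * X u - \<omega> * (X u)\<^sup>2"
  using assms unfolding quadratic_ode_def by blast

lemma quadratic_ode_cong:
  assumes "open I" "\<And>u. u \<in> I \<Longrightarrow> X u = Y u"
  shows "quadratic_ode I b b1 \<omega> X = quadratic_ode I b b1 \<omega> Y"
proof -
  have "(X has_real_derivative d) (at u) \<longleftrightarrow> (Y has_real_derivative d) (at u)" if "u \<in> I" for u d
    using has_field_derivative_transform_within_open[of _ d u I] assms that by metis
  then show ?thesis
    using assms(2) unfolding quadratic_ode_def by simp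
qed

text \<open>The coefficients come from substituting into both equations. The discriminant
  \<open>b1^2 + b \<omega>\<close> is multiplied by \<open>l^2\<close>.\<close>

lemma quadratic_ode_affine:
  assumes "quadratic_ode I b b1 \<omega> X"
    and "b1' = l * b1 + \<omega> * c" "b' = l\<^sup>2 * b - 2 * l * b1 * c - \<omega> * c\<^sup>2"
  shows "quadratic_ode I b' b1' \<omega> (\<lambda>u. l * X u + c)"
  using assms(1)
proof (rule quadratic_odeE)
  fix D
  assume D: "\<And>u. u \<in> I \<Longrightarrow> (X has_real_derivative D u) (at u)"
    "\<And>u. u \<in> I \<Longrightarrow> (D has_real_derivative b1 - \<omega> * X u) (at u)"
    "\<And>u. u \<in> I \<Longrightarrow> (D u)\<^sup>2 = b + 2 * b1 * X u - \<omega> * (X u)\<^sup>2"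
  show ?thesis
  proof (rule quadratic_odeI)
    fix u assume u: "u \<in> I"
    show "((\<lambda>u. l * X u + c) has_real_derivative l * D u) (at u)"
      by (auto intro!: derivative_eq_intros D u)
    show "((\<lambda>u. l * D u) has_real_derivative b1' - \<omega> * (l * X u + c)) (at u)"
      by (rule derivative_eq_intros D u refl)+ (simp add: assms algebra_simps)
    show "(l * D u)\<^sup>2 = b' + 2 * b1' * (l * X u + c) - \<omega> * (l * X u + c)\<^sup>2"
      unfolding power_mult_distrib D(3)[OF u] assms by (simp add: power2_eq_square algebra_simps)
  qed
qed

lemma quadratic_ode_affine_iff:
  assumes "l \<noteq> 0" "b1' = l * b1 + \<omega> * c" "b' = l\<^sup>2 * b - 2 * l * b1 * c - \<omega> * c\<^sup>2"
  shows "quadratic_ode I b' b1' \<omega> (\<lambda>u. l * X u + c) \<longleftrightarrow> quadratic_ode I b b1 \<omega> X"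
proof
  assume ode: "quadratic_ode I b' b1' \<omega> (\<lambda>u. l * X u + c)"
  have "b1 = 1 / l * b1' + \<omega> * (- c / l)"
    using assms by (simp add: field_simps)
  moreover have "b = (1 / l)\<^sup>2 * b' - 2 * (1 / l) * b1' * (- c / l) - \<omega> * (- c / l)\<^sup>2"
    using assms(1) unfolding assms(2,3) by (simp add: divide_simps) (simp add: power2_eq_square algebra_simps)
  ultimately have "quadratic_ode I b b1 \<omega> (\<lambda>u. 1 / l * (l * X u + c) + - c / l)"
    by (rule quadratic_ode_affine[OF ode])
  moreover have "1 / l * (l * X u + c) + - c / l = X u" for u
    using assms(1) by (simp add: field_simps)
  ultimately show "quadratic_ode I b b1 \<omega> X" by simp
qed (use quadratic_ode_affine assms in blast)

text \<open>The pair \<open>v = \<omega> X - b1\<close>, \<open>y = \<nu> D\<close> rotates with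
  speed \<open>\<nu>\<close> on the circle \<open>v^2 + y^2 = E\<close>. Its coordinates
  \<open>c1\<close>, \<open>c2\<close> in a co-rotating frame are constant, and their polar angle is
  the phase.\<close>

lemma quadratic_ode_pos:
  assumes I: "open I" "connected I" "I \<noteq> {}" and \<omega>: "\<omega> > 0"
  shows "quadratic_ode I b b1 \<omega> X \<longleftrightarrow> b1\<^sup>2 + b * \<omega> \<ge> 0 \<and>
    (\<exists>u0. \<forall>u\<in>I. X u = (b1 + sqrt (b1\<^sup>2 + b * \<omega>) * sin (sqrt \<omega> * (u - u0))) / \<omega>)"
proof
  define \<nu> where "\<nu> = sqrt \<omega>"
  have \<nu>: "\<nu> > 0" "\<omega> = \<nu>\<^sup>2"
    using \<omega> by (simp_all add: \<nu>_def)
  define E where "E = b1\<^sup>2 + b * \<omega>"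
  assume "quadratic_ode I b b1 \<omega> X"
  then show "b1\<^sup>2 + b * \<omega> \<ge> 0 \<and>
    (\<exists>u0. \<forall>u\<in>I. X u = (b1 + sqrt (b1\<^sup>2 + b * \<omega>) * sin (sqrt \<omega> * (u - u0))) / \<omega>)"
  proof (rule quadratic_odeE)
    fix D
    assume D: "\<And>u. u \<in> I \<Longrightarrow> (X has_real_derivative D u) (at u)"
      "\<And>u. u \<in> I \<Longrightarrow> (D has_real_derivative b1 - \<omega> * X u) (at u)"
      "\<And>u. u \<in> I \<Longrightarrow> (D u)\<^sup>2 = b + 2 * b1 * X u - \<omega> * (X u)\<^sup>2"
    define v where "v u = \<omega> * X u - b1" for u
    define y where "y u = \<nu> * D u" for u
    have v: "(v has_real_derivative \<nu> * y u) (at u)" if "u \<in> I" for u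
      unfolding v_def[abs_def] y_def by (rule derivative_eq_intros D that refl)+ (simp add: \<nu> power2_eq_square)
    have y: "(y has_real_derivative - \<nu> * v u) (at u)" if "u \<in> I" for u
      unfolding y_def[abs_def] v_def by (rule derivative_eq_intros D that refl)+ (simp add: algebra_simps)
    have E: "(v u)\<^sup>2 + (y u)\<^sup>2 = E" if "u \<in> I" for u
      unfolding y_def v_def power_mult_distrib \<nu>(2)[symmetric] D(3)[OF that] E_def
      by (simp add: power2_eq_square algebra_simps)
    have "((\<lambda>u. v u * sin (\<nu> * u) + y u * cos (\<nu> * u)) has_real_derivative 0) (at u)" if "u \<in> I" for u
      by (rule derivative_eq_intros v y that refl)+ (simp add: algebra_simps)
    from zero_derivative_constant[OF I(2,1) this] obtain c1 where
      c1: "\<And>u. u \<in> I \<Longrightarrow> v u * sin (\<nu> * u) + y u * cos (\<nu> * u) = c1" by blast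
    have "((\<lambda>u. v u * cos (\<nu> * u) - y u * sin (\<nu> * u)) has_real_derivative 0) (at u)" if "u \<in> I" for u
      by (rule derivative_eq_intros v y that refl)+ (simp add: algebra_simps)
    from zero_derivative_constant[OF I(2,1) this] obtain c2 where
      c2: "\<And>u. u \<in> I \<Longrightarrow> v u * cos (\<nu> * u) - y u * sin (\<nu> * u) = c2" by blast
    have vc: "v u = c1 * sin (\<nu> * u) + c2 * cos (\<nu> * u)" if "u \<in> I" for u
    proof -
      have "c1 * sin (\<nu> * u) + c2 * cos (\<nu> * u) = v u * ((sin (\<nu> * u))\<^sup>2 + (cos (\<nu> * u))\<^sup>2)"
        unfolding c1[OF that, symmetric] c2[OF that, symmetric] by algebra
      then show ?thesis by simp
    qed
    obtain w where w: "w \<in> I" using I(3) by blast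
    have cE: "c1\<^sup>2 + c2\<^sup>2 = E"
    proof -
      have "c1\<^sup>2 + c2\<^sup>2 = ((v w)\<^sup>2 + (y w)\<^sup>2) * ((sin (\<nu> * w))\<^sup>2 + (cos (\<nu> * w))\<^sup>2)"
        unfolding c1[OF w, symmetric] c2[OF w, symmetric] by algebra
      then show ?thesis by (simp add: E[OF w])
    qed
    then have E0: "E \<ge> 0"
      by (metis sum_power2_ge_zero)
    \<comment> \<open>For \<open>E = 0\<close> both constants vanish and any phase works; otherwise
      they are scaled to the unit circle.\<close>
    obtain \<phi> where \<phi>: "c1 = sqrt E * cos \<phi>" "c2 = sqrt E * sin \<phi>"
    proof (cases "E = 0")
      case True
      then show thesis using cE that by simp
    next
      case False
      then have "(c1 / sqrt E)\<^sup>2 + (c2 / sqrt E)\<^sup>2 = 1"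
        using cE E0 by (simp add: power_divide flip: add_divide_distrib)
      then obtain \<phi> where "c1 / sqrt E = cos \<phi>" "c2 / sqrt E = sin \<phi>"
        by (rule sincos_total_2pi)
      then show thesis using that[of \<phi>] False by (simp add: field_simps)
    qed
    have "X u = (b1 + sqrt E * sin (sqrt \<omega> * (u - (- \<phi> / \<nu>)))) / \<omega>" if "u \<in> I" for u
    proof -
      have "sqrt \<omega> * (u - (- \<phi> / \<nu>)) = \<nu> * u + \<phi>"
        using \<nu>(1) unfolding \<nu>_def[symmetric] by (simp add: field_simps)
      then have "v u = sqrt E * sin (sqrt \<omega> * (u - (- \<phi> / \<nu>)))"
        using vc[OF that] by (simp add: \<phi> sin_add algebra_simps)
      then show ?thesis
        using \<omega> by (simp add: v_def field_simps)
    qed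
    then show ?thesis
      using E0 unfolding E_def by blast
  qed
next
  define E where "E = b1\<^sup>2 + b * \<omega>"
  define \<nu> where "\<nu> = sqrt \<omega>"
  have \<nu>: "\<nu> > 0" "\<omega> = \<nu>\<^sup>2"
    using \<omega> by (simp_all add: \<nu>_def)
  assume "b1\<^sup>2 + b * \<omega> \<ge> 0 \<and>
    (\<exists>u0. \<forall>u\<in>I. X u = (b1 + sqrt (b1\<^sup>2 + b * \<omega>) * sin (sqrt \<omega> * (u - u0))) / \<omega>)"
  then obtain u0 where E0: "E \<ge> 0" and X: "\<And>u. u \<in> I \<Longrightarrow> X u = (b1 + sqrt E * sin (\<nu> * (u - u0))) / \<omega>"
    unfolding E_def \<nu>_def by blast
  have "quadratic_ode I b b1 \<omega> (\<lambda>u. (b1 + sqrt E * sin (\<nu> * (u - u0))) / \<omega>)"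
  proof (rule quadratic_odeI)
    fix u
    show "((\<lambda>u. (b1 + sqrt E * sin (\<nu> * (u - u0))) / \<omega>) has_real_derivative
        sqrt E * cos (\<nu> * (u - u0)) / \<nu>) (at u)"
      using \<nu>(1) unfolding \<nu>(2) by (auto intro!: derivative_eq_intros simp: power2_eq_square)
    show "((\<lambda>u. sqrt E * cos (\<nu> * (u - u0)) / \<nu>) has_real_derivative
        b1 - \<omega> * ((b1 + sqrt E * sin (\<nu> * (u - u0))) / \<omega>)) (at u)"
      using \<nu>(1) unfolding \<nu>(2) by (auto intro!: derivative_eq_intros)
    have "(sqrt E)\<^sup>2 = b1\<^sup>2 + b * \<nu>\<^sup>2" using E0 \<nu>(2) by (simp add: E_def)
    then show "(sqrt E * cos (\<nu> * (u - u0)) / \<nu>)\<^sup>2 = b + 2 * b1 * ((b1 + sqrt E * sin (\<nu> * (u - u0))) / \<omega>) -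
         \<omega> * ((b1 + sqrt E * sin (\<nu> * (u - u0))) / \<omega>)\<^sup>2"
    proof -
      define q where "q = b1 + sqrt E * sin (\<nu> * (u - u0))"
      have "(sqrt E * cos (\<nu> * (u - u0)))\<^sup>2 = b * \<nu>\<^sup>2 + 2 * b1 * q - q\<^sup>2"
        unfolding q_def using sin_cos_squared_add[of "\<nu> * (u - u0)"] \<open>(sqrt E)\<^sup>2 = _\<close> by algebra
      then show ?thesis
        using \<nu>(1) unfolding q_def[symmetric] \<nu>(2)
        by (simp add: power_divide) (simp add: field_simps power2_eq_square power4_eq_xxxx)
    qed
  qed
  then show "quadratic_ode I b b1 \<omega> X"
    using quadratic_ode_cong[OF I(1) X] by simp
qed

text \<open>Now \<open>v + y\<close> and \<open>v - y\<close> are pure exponentials with product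
  \<open>E > 0\<close>, so their coefficients \<open>P\<close>, \<open>Q\<close> have the same sign.
  The side condition says \<open>v < 0\<close> and selects the negative sign, hence - cosh.\<close>

lemma quadratic_ode_neg:
  assumes I: "open I" "connected I" "I \<noteq> {}" and \<omega>: "\<omega> < 0" and E0: "b1\<^sup>2 + b * \<omega> > 0"
  shows "quadratic_ode I b b1 \<omega> X \<and> (\<forall>u\<in>I. \<omega> * X u < b1) \<longleftrightarrow>
    (\<exists>u0. \<forall>u\<in>I. X u = (b1 - sqrt (b1\<^sup>2 + b * \<omega>) * cosh (sqrt (- \<omega>) * (u - u0))) / \<omega>)"
proof
  define \<nu> where "\<nu> = sqrt (- \<omega>)"
  have \<nu>: "\<nu> > 0" "\<omega> = - \<nu>\<^sup>2"
    using \<omega> by (simp_all add: \<nu>_def)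
  define E where "E = b1\<^sup>2 + b * \<omega>"
  have E_pos: "E > 0" using E0 by (simp add: E_def)
  assume "quadratic_ode I b b1 \<omega> X \<and> (\<forall>u\<in>I. \<omega> * X u < b1)"
  then have "quadratic_ode I b b1 \<omega> X" and neg: "\<And>u. u \<in> I \<Longrightarrow> \<omega> * X u < b1" by blast+
  from this(1) show "\<exists>u0. \<forall>u\<in>I. X u = (b1 - sqrt (b1\<^sup>2 + b * \<omega>) * cosh (sqrt (- \<omega>) * (u - u0))) / \<omega>"
  proof (rule quadratic_odeE)
    fix D
    assume D: "\<And>u. u \<in> I \<Longrightarrow> (X has_real_derivative D u) (at u)"
      "\<And>u. u \<in> I \<Longrightarrow> (D has_real_derivative b1 - \<omega> * X u) (at u)"
      "\<And>u. u \<in> I \<Longrightarrow> (D u)\<^sup>2 = b + 2 * b1 * X u - \<omega> * (X u)\<^sup>2"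
    define v where "v u = \<omega> * X u - b1" for u
    define y where "y u = \<nu> * D u" for u
    have v: "(v has_real_derivative - \<nu> * y u) (at u)" if "u \<in> I" for u
      unfolding v_def[abs_def] y_def by (rule derivative_eq_intros D that refl)+ (simp add: \<nu> power2_eq_square)
    have y: "(y has_real_derivative - \<nu> * v u) (at u)" if "u \<in> I" for u
      unfolding y_def[abs_def] v_def by (rule derivative_eq_intros D that refl)+ (simp add: algebra_simps)
    have E: "(v u + y u) * (v u - y u) = E" if "u \<in> I" for u
    proof -
      have "(v u)\<^sup>2 + \<omega> * (D u)\<^sup>2 = E"
        unfolding v_def D(3)[OF that] E_def by (simp add: power2_eq_square algebra_simps)
      then show ?thesis
        unfolding y_def \<nu>(2) by (simp add: power2_eq_square algebra_simps)
    qed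
    have "((\<lambda>u. (v u + y u) * exp (\<nu> * u)) has_real_derivative 0) (at u)" if "u \<in> I" for u
      by (rule derivative_eq_intros v y that refl)+ (simp add: algebra_simps)
    from zero_derivative_constant[OF I(2,1) this] obtain P where
      P: "\<And>u. u \<in> I \<Longrightarrow> (v u + y u) * exp (\<nu> * u) = P" by blast
    have "((\<lambda>u. (v u - y u) * exp (- (\<nu> * u))) has_real_derivative 0) (at u)" if "u \<in> I" for u
      by (rule derivative_eq_intros v y that refl)+ (simp add: algebra_simps)
    from zero_derivative_constant[OF I(2,1) this] obtain Q where
      Q: "\<And>u. u \<in> I \<Longrightarrow> (v u - y u) * exp (- (\<nu> * u)) = Q" by blast
    have vPQ: "2 * v u = P * exp (- (\<nu> * u)) + Q * exp (\<nu> * u)" if "u \<in> I" for u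
      unfolding P[OF that, symmetric] Q[OF that, symmetric]
      by (simp add: mult.assoc flip: exp_add)
    obtain w where w: "w \<in> I" using I(3) by blast
    have "P * Q = ((v w + y w) * (v w - y w)) * (exp (\<nu> * w) * exp (- (\<nu> * w)))"
      unfolding P[OF w, symmetric] Q[OF w, symmetric] by (simp only: mult_ac)
    then have PQ: "P * Q = E"
      by (simp add: E[OF w] flip: exp_add)
    have "Q < 0"
    proof (rule ccontr)
      assume "\<not> Q < 0"
      then have "Q > 0" "P > 0"
        using PQ E_pos by (auto simp: zero_less_mult_iff not_less le_less)
      then have "2 * v w > 0"
        unfolding vPQ[OF w] by (intro add_pos_pos mult_pos_pos) auto
      then show False using neg[OF w] by (simp add: v_def)
    qed
    \<comment> \<open>Chosen to balance the two exponentials: both amplitudes \<open>-P\<close> and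
      \<open>-Q\<close> become \<open>sqrt E\<close> when measured from \<open>u0\<close>.\<close>
    define u0 where "u0 = - ln (- Q / sqrt E) / \<nu>"
    have e1: "exp (- (\<nu> * u0)) = - Q / sqrt E"
      using \<open>Q < 0\<close> E_pos \<nu>(1) by (simp add: u0_def divide_less_0_iff)
    then have e2: "exp (\<nu> * u0) = sqrt E / - Q"
      using exp_minus[of "- (\<nu> * u0)"] by (simp add: field_simps)
    have "X u = (b1 - sqrt E * cosh (sqrt (- \<omega>) * (u - u0))) / \<omega>" if u: "u \<in> I" for u
    proof -
      have "sqrt E * (2 * cosh (sqrt (- \<omega>) * (u - u0))) =
          sqrt E * (exp (\<nu> * u) * exp (- (\<nu> * u0)) + exp (- (\<nu> * u)) * exp (\<nu> * u0))"
        unfolding \<nu>_def[symmetric] cosh_field_def by (simp add: algebra_simps flip: exp_add)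
      also have "\<dots> = sqrt E * sqrt E / - Q * exp (- (\<nu> * u)) - Q * exp (\<nu> * u)"
        unfolding e1 e2 using E_pos by (simp add: field_simps)
      also have "sqrt E * sqrt E / - Q = - P"
        using PQ \<open>Q < 0\<close> E_pos by (simp add: field_simps)
      finally have "v u = - (sqrt E * cosh (sqrt (- \<omega>) * (u - u0)))"
        using vPQ[OF u] by simp
      then show ?thesis
        using \<omega> by (simp add: v_def field_simps)
    qed
    then show ?thesis unfolding E_def by blast
  qed
next
  define E where "E = b1\<^sup>2 + b * \<omega>"
  have E_pos: "E > 0" using E0 by (simp add: E_def)
  define \<nu> where "\<nu> = sqrt (- \<omega>)"
  have \<nu>: "\<nu> > 0" "\<omega> = - \<nu>\<^sup>2"
    using \<omega> by (simp_all add: \<nu>_def)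
  assume "\<exists>u0. \<forall>u\<in>I. X u = (b1 - sqrt (b1\<^sup>2 + b * \<omega>) * cosh (sqrt (- \<omega>) * (u - u0))) / \<omega>"
  then obtain u0 where X: "\<And>u. u \<in> I \<Longrightarrow> X u = (b1 - sqrt E * cosh (\<nu> * (u - u0))) / \<omega>"
    unfolding E_def \<nu>_def by blast
  have "quadratic_ode I b b1 \<omega> (\<lambda>u. (b1 - sqrt E * cosh (\<nu> * (u - u0))) / \<omega>)"
  proof (rule quadratic_odeI)
    fix u
    show "((\<lambda>u. (b1 - sqrt E * cosh (\<nu> * (u - u0))) / \<omega>) has_real_derivative
        sqrt E * sinh (\<nu> * (u - u0)) / \<nu>) (at u)"
      using \<nu>(1) unfolding \<nu>(2) by (auto intro!: derivative_eq_intros simp: power2_eq_square)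
    show "((\<lambda>u. sqrt E * sinh (\<nu> * (u - u0)) / \<nu>) has_real_derivative
        b1 - \<omega> * ((b1 - sqrt E * cosh (\<nu> * (u - u0))) / \<omega>)) (at u)"
      using \<nu>(1) unfolding \<nu>(2) by (auto intro!: derivative_eq_intros)
    have "(sqrt E)\<^sup>2 = b1\<^sup>2 - b * \<nu>\<^sup>2" using E_pos \<nu>(2) by (simp add: E_def)
    then show "(sqrt E * sinh (\<nu> * (u - u0)) / \<nu>)\<^sup>2 = b + 2 * b1 * ((b1 - sqrt E * cosh (\<nu> * (u - u0))) / \<omega>) -
         \<omega> * ((b1 - sqrt E * cosh (\<nu> * (u - u0))) / \<omega>)\<^sup>2"
    proof -
      define q where "q = b1 - sqrt E * cosh (\<nu> * (u - u0))"
      have "(sqrt E * sinh (\<nu> * (u - u0)))\<^sup>2 = b * \<nu>\<^sup>2 - 2 * b1 * q + q\<^sup>2"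
        unfolding q_def using cosh_square_eq[of "\<nu> * (u - u0)"] \<open>(sqrt E)\<^sup>2 = _\<close> by algebra
      then show ?thesis
        using \<nu>(1) unfolding q_def[symmetric] \<nu>(2)
        by (simp add: power_divide) (simp add: field_simps power2_eq_square power4_eq_xxxx)
    qed
  qed
  then have "quadratic_ode I b b1 \<omega> X"
    using quadratic_ode_cong[OF I(1) X] by simp
  moreover have "\<omega> * X u < b1" if "u \<in> I" for u
    using \<omega> E_pos cosh_real_pos[of "\<nu> * (u - u0)"] by (simp add: X[OF that])
  ultimately show "quadratic_ode I b b1 \<omega> X \<and> (\<forall>u\<in>I. \<omega> * X u < b1)" by blast
qed

text \<open>Only \<open>D\<close> is integrated, to an affine function of \<open>u\<close>;
  \<open>X\<close> is then read off from the first integral, which also fixes its additive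
  constant.\<close>

lemma quadratic_ode_zero:
  assumes I: "open I" "connected I" and b1: "b1 \<noteq> 0"
  shows "quadratic_ode I b b1 0 X \<longleftrightarrow> (\<exists>u0. \<forall>u\<in>I. X u = b1 / 2 * (u - u0)\<^sup>2 + - b / (2 * b1))"
proof
  assume "quadratic_ode I b b1 0 X"
  then show "\<exists>u0. \<forall>u\<in>I. X u = b1 / 2 * (u - u0)\<^sup>2 + - b / (2 * b1)"
  proof (rule quadratic_odeE)
    fix D
    assume D: "\<And>u. u \<in> I \<Longrightarrow> (X has_real_derivative D u) (at u)"
      "\<And>u. u \<in> I \<Longrightarrow> (D has_real_derivative b1 - 0 * X u) (at u)"
      "\<And>u. u \<in> I \<Longrightarrow> (D u)\<^sup>2 = b + 2 * b1 * X u - 0 * (X u)\<^sup>2"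
    have "((\<lambda>u. D u - b1 * u) has_real_derivative 0) (at u)" if "u \<in> I" for u
      using D(2)[OF that] by (auto intro!: derivative_eq_intros)
    from zero_derivative_constant[OF I(2,1) this] obtain d where
      d: "\<And>u. u \<in> I \<Longrightarrow> D u - b1 * u = d" by blast
    have "X u = b1 / 2 * (u - (- d / b1))\<^sup>2 + - b / (2 * b1)" if "u \<in> I" for u
    proof -
      have "D u = b1 * (u - (- d / b1))"
        using d[OF that] b1 by (simp add: field_simps)
      then have "b1\<^sup>2 * (u - (- d / b1))\<^sup>2 = b + 2 * b1 * X u"
        using D(3)[OF that] by (simp add: power_mult_distrib)
      moreover define q where "q = (u - (- d / b1))\<^sup>2"
      ultimately show ?thesis
        using b1 by (simp add: q_def[symmetric]) (simp add: field_simps power2_eq_square)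
    qed
    then show ?thesis by blast
  qed
next
  assume "\<exists>u0. \<forall>u\<in>I. X u = b1 / 2 * (u - u0)\<^sup>2 + - b / (2 * b1)"
  then obtain u0 where X: "\<And>u. u \<in> I \<Longrightarrow> X u = b1 / 2 * (u - u0)\<^sup>2 + - b / (2 * b1)" by blast
  have "quadratic_ode I b b1 0 (\<lambda>u. b1 / 2 * (u - u0)\<^sup>2 + - b / (2 * b1))"
    by (rule quadratic_odeI[where D = "\<lambda>u. b1 * (u - u0)"])
      (use b1 in \<open>auto intro!: derivative_eq_intros simp: field_simps power2_eq_square\<close>)
  then show "quadratic_ode I b b1 0 X"
    using quadratic_ode_cong[OF I(1) X] by simp
qed

subsection \<open>Comparison of the constants\<close>

context bcv_helicoid begin

lemma cmc_iff_quadratic_ode: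
  "has_constant_mean_curvature (bcv_metric \<kappa> \<tau>) (I \<times> UNIV) \<psi> H \<longleftrightarrow>
    (\<exists>k. quadratic_ode I (- 4 * k\<^sup>2) (2 - 2 * H * k) (H\<^sup>2 + \<kappa>) p)"
proof -
  have "quadratic_ode I b b1 \<omega> p \<longleftrightarrow> (\<forall>u\<in>I. deriv (deriv p) u = b1 - \<omega> * p u \<and>
      (deriv p u)\<^sup>2 = b + 2 * b1 * p u - \<omega> * (p u)\<^sup>2)" (is "_ \<longleftrightarrow> ?r") for b b1 \<omega>
  proof
    assume "quadratic_ode I b b1 \<omega> p"
    then show ?r
    proof (rule quadratic_odeE)
      fix D
      assume D: "\<And>u. u \<in> I \<Longrightarrow> (p has_real_derivative D u) (at u)"
        "\<And>u. u \<in> I \<Longrightarrow> (D has_real_derivative b1 - \<omega> * p u) (at u)"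
        "\<And>u. u \<in> I \<Longrightarrow> (D u)\<^sup>2 = b + 2 * b1 * p u - \<omega> * (p u)\<^sup>2"
      have eq: "D u = deriv p u" if "u \<in> I" for u
        using D(1)[OF that] DERIV_imp_deriv by metis
      have "(deriv p has_real_derivative b1 - \<omega> * p u) (at u)" if "u \<in> I" for u
        by (rule has_field_derivative_transform_within_open[OF D(2) open_I]) (use that eq in auto)
      then show ?r
        using D(3) eq DERIV_imp_deriv by metis
    qed
  next
    assume r: ?r
    show "quadratic_ode I b b1 \<omega> p"
      by (rule quadratic_odeI[OF p_deriv']) (use r p'_deriv in \<open>auto simp: algebra_simps\<close>)
  qed
  then show ?thesis
    unfolding has_cmc_iff cmc_iff_ode by simp
qed

lemma cmc_iff_ode_s:
  assumes ne: "\<kappa> \<noteq> 4 * \<tau>\<^sup>2"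
  shows "has_constant_mean_curvature (bcv_metric \<kappa> \<tau>) (I \<times> UNIV) \<psi> H \<longleftrightarrow>
    (\<exists>c. quadratic_ode I (const_b \<kappa> \<tau> a c) (const_b1 \<kappa> \<tau> H a c) (H\<^sup>2 + \<kappa>) s)"
proof -
  define l where "l = (4 * \<tau>\<^sup>2 - \<kappa>) / 2"
  have l: "l \<noteq> 0" using ne by (simp add: l_def)
  \<comment> \<open>Suggested by the terms with \<open>H\<close> in \<open>const_b1\<close>; the
    same value then also makes \<open>const_b\<close> agree.\<close>
  define c where "c k = k * (4 * \<tau>\<^sup>2 - \<kappa>) - H * (1 - 2 * a * \<tau>)" for k
  have "quadratic_ode I (- 4 * k\<^sup>2) (2 - 2 * H * k) (H\<^sup>2 + \<kappa>) p \<longleftrightarrow>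
      quadratic_ode I (const_b \<kappa> \<tau> a (c k)) (const_b1 \<kappa> \<tau> H a (c k)) (H\<^sup>2 + \<kappa>) s" for k
  proof -
    have "const_b1 \<kappa> \<tau> H a (c k) = l * (2 - 2 * H * k) + (H\<^sup>2 + \<kappa>) * (1 - 2 * a * \<tau>)"
      by (simp add: const_b1_def c_def l_def field_simps power2_eq_square)
    moreover have "const_b \<kappa> \<tau> a (c k) = l\<^sup>2 * (- 4 * k\<^sup>2) - 2 * l * (2 - 2 * H * k) * (1 - 2 * a * \<tau>)
        - (H\<^sup>2 + \<kappa>) * (1 - 2 * a * \<tau>)\<^sup>2"
      by (simp add: const_b_def c_def l_def field_simps power2_eq_square)
    ultimately have "quadratic_ode I (const_b \<kappa> \<tau> a (c k)) (const_b1 \<kappa> \<tau> H a (c k)) (H\<^sup>2 + \<kappa>)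
          (\<lambda>u. l * p u + (1 - 2 * a * \<tau>)) \<longleftrightarrow>
        quadratic_ode I (- 4 * k\<^sup>2) (2 - 2 * H * k) (H\<^sup>2 + \<kappa>) p"
      by (rule quadratic_ode_affine_iff[OF l])
    moreover have "l * p u + (1 - 2 * a * \<tau>) = s u" if "u \<in> I" for u
      unfolding s_eq[OF that] l_def by simp
    ultimately show ?thesis
      using quadratic_ode_cong[OF open_I, of "\<lambda>u. l * p u + (1 - 2 * a * \<tau>)" s] by simp
  qed
  moreover have "\<exists>k. c k = x" for x
    using l by (intro exI[of _ "(x + H * (1 - 2 * a * \<tau>)) / (4 * \<tau>\<^sup>2 - \<kappa>)"]) (simp add: c_def l_def)
  ultimately show ?thesis
    unfolding cmc_iff_quadratic_ode by metis
qed

text \<open>Here \<open>s\<close> is the constant \<open>1 - 2 a \<tau>\<close> and cannot carry the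
  equation, but the quadratic term in \<open>U_eq\<close> disappears. Positivity of \<open>s\<close>
  at a point of \<open>I\<close> makes the slope \<open>l\<close> nonzero.\<close>

lemma cmc_iff_ode_U:
  assumes eq: "\<kappa> = 4 * \<tau>\<^sup>2"
  shows "has_constant_mean_curvature (bcv_metric \<kappa> \<tau>) (I \<times> UNIV) \<psi> H \<longleftrightarrow>
    (\<exists>c. quadratic_ode I (const_c2 \<tau> a c) (const_c1 \<tau> H a c) (H\<^sup>2 + 4 * \<tau>\<^sup>2) (\<lambda>u. m\<^sup>2 * (U u)\<^sup>2))"
proof -
  define l where "l = 1 - 2 * a * \<tau>"
  have l: "l \<noteq> 0"
    using I_nonempty s_eq s_pos by (force simp: eq l_def)
  define c where "c k = 2 * k * l - H * a\<^sup>2" for k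
  have "quadratic_ode I (- 4 * k\<^sup>2) (2 - 2 * H * k) (H\<^sup>2 + \<kappa>) p \<longleftrightarrow>
      quadratic_ode I (const_c2 \<tau> a (c k)) (const_c1 \<tau> H a (c k)) (H\<^sup>2 + 4 * \<tau>\<^sup>2) (\<lambda>u. m\<^sup>2 * (U u)\<^sup>2)" for k
  proof -
    have "const_c1 \<tau> H a (c k) = l * (2 - 2 * H * k) + (H\<^sup>2 + \<kappa>) * a\<^sup>2"
      by (simp add: const_c1_def c_def l_def eq field_simps power2_eq_square)
    moreover have "const_c2 \<tau> a (c k) = l\<^sup>2 * (- 4 * k\<^sup>2) - 2 * l * (2 - 2 * H * k) * a\<^sup>2
        - (H\<^sup>2 + \<kappa>) * (a\<^sup>2)\<^sup>2"
      by (simp add: const_c2_def c_def l_def eq field_simps power2_eq_square)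
    ultimately have "quadratic_ode I (const_c2 \<tau> a (c k)) (const_c1 \<tau> H a (c k)) (H\<^sup>2 + \<kappa>)
          (\<lambda>u. l * p u + a\<^sup>2) \<longleftrightarrow>
        quadratic_ode I (- 4 * k\<^sup>2) (2 - 2 * H * k) (H\<^sup>2 + \<kappa>) p"
      by (rule quadratic_ode_affine_iff[OF l])
    moreover have "l * p u + a\<^sup>2 = m\<^sup>2 * (U u)\<^sup>2" if "u \<in> I" for u
      unfolding U_eq[OF that] by (simp add: l_def eq)
    ultimately show ?thesis
      using quadratic_ode_cong[OF open_I, of "\<lambda>u. l * p u + a\<^sup>2" "\<lambda>u. m\<^sup>2 * (U u)\<^sup>2"] by (simp add: eq)
  qed
  moreover have "\<exists>k. c k = x" for x
    using l by (intro exI[of _ "(x + H * a\<^sup>2) / (2 * l)"]) (simp add: c_def field_simps)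
  ultimately show ?thesis
    unfolding cmc_iff_quadratic_ode by metis
qed

text \<open>The formula for \<open>U\<close> is equivalent to \<open>s^2 = w^2\<close>; since
  \<open>s > 0\<close>, the condition \<open>w > 0\<close> excludes \<open>s = - w\<close>.\<close>

lemma U_iff_s:
  assumes ne: "\<kappa> \<noteq> 4 * \<tau>\<^sup>2" and u: "u \<in> I"
  shows "w > 0 \<and> (U u)\<^sup>2 = (w\<^sup>2 + const_b3 \<kappa> \<tau> a) / (m\<^sup>2 * (4 * \<tau>\<^sup>2 - \<kappa>)) \<longleftrightarrow> s u = w"
proof -
  have m0: "m\<^sup>2 * (4 * \<tau>\<^sup>2 - \<kappa>) \<noteq> 0"
    using ne m by simp
  have "(U u)\<^sup>2 * (m\<^sup>2 * (4 * \<tau>\<^sup>2 - \<kappa>)) = (s u)\<^sup>2 + const_b3 \<kappa> \<tau> a"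
    unfolding s_sq[OF u] const_b3_def by (simp add: power2_eq_square algebra_simps)
  then have "(U u)\<^sup>2 = (w\<^sup>2 + const_b3 \<kappa> \<tau> a) / (m\<^sup>2 * (4 * \<tau>\<^sup>2 - \<kappa>)) \<longleftrightarrow> (s u)\<^sup>2 = w\<^sup>2"
    unfolding nonzero_eq_divide_eq[OF m0] by simp
  then show ?thesis
    using s_pos[OF u] by (auto simp: power2_eq_iff)
qed

lemma U_iff_s_scaled:
  assumes ne: "\<kappa> \<noteq> 4 * \<tau>\<^sup>2" and u: "u \<in> I" and \<omega>: "\<omega> \<noteq> 0"
  shows "w / \<omega> > 0 \<and> (U u)\<^sup>2 = (\<omega>\<^sup>2 * const_b3 \<kappa> \<tau> a + w\<^sup>2) / (m\<^sup>2 * (4 * \<tau>\<^sup>2 - \<kappa>) * \<omega>\<^sup>2) \<longleftrightarrow> s u = w / \<omega>"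
proof -
  have "(\<omega>\<^sup>2 * const_b3 \<kappa> \<tau> a + w\<^sup>2) / (m\<^sup>2 * (4 * \<tau>\<^sup>2 - \<kappa>) * \<omega>\<^sup>2) =
      ((w / \<omega>)\<^sup>2 + const_b3 \<kappa> \<tau> a) / (m\<^sup>2 * (4 * \<tau>\<^sup>2 - \<kappa>))"
  proof -
    have "\<omega>\<^sup>2 * const_b3 \<kappa> \<tau> a + w\<^sup>2 = ((w / \<omega>)\<^sup>2 + const_b3 \<kappa> \<tau> a) * \<omega>\<^sup>2"
      using \<omega> by (simp add: field_simps)
    then show ?thesis using \<omega> by simp
  qed
  then show ?thesis
    using U_iff_s[OF ne u, of "w / \<omega>"] by simp
qed

section \<open>The cases of the theorem\<close>

lemma cmc_iff_flat:
  assumes "\<kappa> = 0" "\<tau> = 0" "H = 0"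
  shows "has_constant_mean_curvature (bcv_metric \<kappa> \<tau>) (I \<times> UNIV) \<psi> H \<longleftrightarrow>
    (\<exists>c u0. \<forall>u\<in>I. cmc_profile \<kappa> \<tau> H m a c (u - u0) (U u))"
proof -
  have p: "m\<^sup>2 * (U u)\<^sup>2 = p u + a\<^sup>2" if "u \<in> I" for u
    using U_eq[OF that] assms(1,2) by simp
  have "cmc_profile \<kappa> \<tau> H m a c v y \<longleftrightarrow> m\<^sup>2 * y\<^sup>2 = v\<^sup>2 + (c / 2)\<^sup>2 + a\<^sup>2" for c v y
    using m by (auto simp: cmc_profile_def assms field_simps Let_def)
  then have profile: "cmc_profile \<kappa> \<tau> H m a c v (U u) \<longleftrightarrow> p u = v\<^sup>2 + (c / 2)\<^sup>2" if "u \<in> I" for c u v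
    by (simp add: p[OF that])
  have ode: "quadratic_ode I (- 4 * k\<^sup>2) 2 0 p \<longleftrightarrow> (\<exists>u0. \<forall>u\<in>I. p u = (u - u0)\<^sup>2 + k\<^sup>2)" for k
    using quadratic_ode_zero[OF open_I connected_I, of 2 "- 4 * k\<^sup>2" p] by simp
  \<comment> \<open>The parameter of the theorem is \<open>c = 2 k\<close> in the flat case.\<close>
  have half: "(\<exists>k. Q k) \<longleftrightarrow> (\<exists>c. Q (c / 2))" for Q :: "real \<Rightarrow> bool"
    by (metis nonzero_mult_div_cancel_right zero_neq_numeral)
  have A: "2 - 2 * H * k = 2" and \<omega>: "H\<^sup>2 + \<kappa> = 0" for k
    using assms by simp_all
  have "has_constant_mean_curvature (bcv_metric \<kappa> \<tau>) (I \<times> UNIV) \<psi> H \<longleftrightarrow>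
      (\<exists>k u0. \<forall>u\<in>I. p u = (u - u0)\<^sup>2 + k\<^sup>2)"
    unfolding cmc_iff_quadratic_ode A \<omega> ode ..
  also have "\<dots> \<longleftrightarrow> (\<exists>c u0. \<forall>u\<in>I. cmc_profile \<kappa> \<tau> H m a c (u - u0) (U u))"
    unfolding half[of "\<lambda>k. \<exists>u0. \<forall>u\<in>I. p u = (u - u0)\<^sup>2 + k\<^sup>2"] by (simp add: profile)
  finally show ?thesis .
qed

lemma cmc_iff_space_form:
  assumes "\<kappa> = 4 * \<tau>\<^sup>2" "\<kappa> \<noteq> - H\<^sup>2"
  shows "has_constant_mean_curvature (bcv_metric \<kappa> \<tau>) (I \<times> UNIV) \<psi> H \<longleftrightarrow>
    (\<exists>c u0. \<forall>u\<in>I. cmc_profile \<kappa> \<tau> H m a c (u - u0) (U u))"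
proof -
  define \<omega> where "\<omega> = H\<^sup>2 + 4 * \<tau>\<^sup>2"
  have \<omega>: "\<omega> > 0"
    using assms unfolding \<omega>_def by (metis add_nonneg_eq_0_iff add.commute eq_neg_iff_add_eq_0 less_eq_real_def
      mult_nonneg_nonneg zero_le_numeral zero_le_power2 add_nonneg_nonneg)
  have flat: "\<not> (\<kappa> = 0 \<and> \<tau> = 0 \<and> H = 0)"
    using assms by auto
  have profile: "cmc_profile \<kappa> \<tau> H m a c v y \<longleftrightarrow>
      (const_c1 \<tau> H a c)\<^sup>2 + const_c2 \<tau> a c * \<omega> \<ge> 0 \<and>
      m\<^sup>2 * y\<^sup>2 = (const_c1 \<tau> H a c + sqrt ((const_c1 \<tau> H a c)\<^sup>2 + const_c2 \<tau> a c * \<omega>) * sin (sqrt \<omega> * v)) / \<omega>" for c v y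
    using assms flat m \<omega>
    unfolding cmc_profile_def Let_def \<omega>_def[symmetric] add.commute[of "4 * \<tau>\<^sup>2" "H\<^sup>2"]
    by (auto simp: field_simps)
  show ?thesis
    unfolding cmc_iff_ode_U[OF assms(1)] \<omega>_def[symmetric]
      quadratic_ode_pos[OF open_I connected_I I_nonempty \<omega>] profile
    \<comment> \<open>\<open>cmc_profile\<close> carries the discriminant condition at every
      \<open>u\<close>; a point of \<open>I\<close> serves to extract it.\<close>
    using I_nonempty by (simp add: ball_conj_distrib ex_in_conv)
qed

lemma cmc_iff_parabolic:
  assumes "- H\<^sup>2 = \<kappa>" "\<kappa> \<noteq> 4 * \<tau>\<^sup>2"
  shows "has_constant_mean_curvature (bcv_metric \<kappa> \<tau>) (I \<times> UNIV) \<psi> H \<longleftrightarrow>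
    (\<exists>c u0. \<forall>u\<in>I. cmc_profile \<kappa> \<tau> H m a c (u - u0) (U u))"
proof -
  have \<omega>: "H\<^sup>2 + \<kappa> = 0"
    using assms(1) by simp
  have H: "H\<^sup>2 = - \<kappa>" using \<omega> by simp
  have profile: "cmc_profile \<kappa> \<tau> H m a c v (U u) \<longleftrightarrow>
      s u = const_b1 \<kappa> \<tau> H a c / 2 * v\<^sup>2 + const_b2 \<kappa> \<tau> H a c" if u: "u \<in> I" for c v u
    using assms U_iff_s[OF assms(2) u, of "const_b1 \<kappa> \<tau> H a c / 2 * v\<^sup>2 + const_b2 \<kappa> \<tau> H a c"]
    unfolding cmc_profile_def Let_def H by auto
  have "quadratic_ode I (const_b \<kappa> \<tau> a c) (const_b1 \<kappa> \<tau> H a c) (H\<^sup>2 + \<kappa>) s \<longleftrightarrow>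
      (\<exists>u0. \<forall>u\<in>I. s u = const_b1 \<kappa> \<tau> H a c / 2 * (u - u0)\<^sup>2 + const_b2 \<kappa> \<tau> H a c)" for c
  proof (cases "const_b1 \<kappa> \<tau> H a c = 0")
    case True
    \<comment> \<open>Eliminate \<open>c\<close> with
      \<open>c H = 4 \<tau>^2 - 2 a \<kappa> \<tau>\<close> and use \<open>H^2 = - \<kappa>\<close>.
      A negative \<open>b\<close> then contradicts \<open>D^2 = b\<close>.\<close>
    have "H\<^sup>2 * const_b \<kappa> \<tau> a c = - (4 * \<tau>\<^sup>2 - \<kappa>)\<^sup>2"
      using True \<omega> unfolding const_b_def const_b1_def by algebra
    moreover have "(4 * \<tau>\<^sup>2 - \<kappa>)\<^sup>2 > 0"
      using assms(2) by simp
    ultimately have "H\<^sup>2 * const_b \<kappa> \<tau> a c < 0"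
      by linarith
    then have b: "const_b \<kappa> \<tau> a c < 0"
      by (simp add: mult_less_0_iff)
    have "\<not> quadratic_ode I (const_b \<kappa> \<tau> a c) (const_b1 \<kappa> \<tau> H a c) (H\<^sup>2 + \<kappa>) s"
    proof
      assume "quadratic_ode I (const_b \<kappa> \<tau> a c) (const_b1 \<kappa> \<tau> H a c) (H\<^sup>2 + \<kappa>) s"
      then obtain D where "\<And>u. u \<in> I \<Longrightarrow> (D u)\<^sup>2 = const_b \<kappa> \<tau> a c"
        unfolding quadratic_ode_def True \<omega> by auto
      then show False
        using b I_nonempty by (metis ex_in_conv not_less zero_le_power2)
    qed
    moreover have "s u \<noteq> const_b1 \<kappa> \<tau> H a c / 2 * v\<^sup>2 + const_b2 \<kappa> \<tau> H a c" if "u \<in> I" for u v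
      using s_pos[OF that] True by (simp add: const_b2_def)
    ultimately show ?thesis
      using I_nonempty by blast
  next
    case False
    then show ?thesis
      unfolding \<omega> const_b2_def by (rule quadratic_ode_zero[OF open_I connected_I])
  qed
  then show ?thesis
    unfolding cmc_iff_ode_s[OF assms(2)] by (simp add: profile)
qed

lemma cmc_iff_elliptic:
  assumes "- H\<^sup>2 < \<kappa>" "\<kappa> \<noteq> 4 * \<tau>\<^sup>2"
  shows "has_constant_mean_curvature (bcv_metric \<kappa> \<tau>) (I \<times> UNIV) \<psi> H \<longleftrightarrow>
    (\<exists>c u0. \<forall>u\<in>I. cmc_profile \<kappa> \<tau> H m a c (u - u0) (U u))"
proof -
  have \<omega>: "H\<^sup>2 + \<kappa> > 0"
    using assms(1) by simp
  have profile: "cmc_profile \<kappa> \<tau> H m a c v (U u) \<longleftrightarrow>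
      (const_b1 \<kappa> \<tau> H a c)\<^sup>2 + const_b \<kappa> \<tau> a c * (H\<^sup>2 + \<kappa>) \<ge> 0 \<and>
      s u = (const_b1 \<kappa> \<tau> H a c + sqrt ((const_b1 \<kappa> \<tau> H a c)\<^sup>2 + const_b \<kappa> \<tau> a c * (H\<^sup>2 + \<kappa>))
        * sin (sqrt (H\<^sup>2 + \<kappa>) * v)) / (H\<^sup>2 + \<kappa>)" if u: "u \<in> I" for c v u
    using assms \<omega> unfolding U_iff_s_scaled[OF assms(2) u less_imp_neq[OF \<omega>, symmetric], symmetric]
    by (auto simp: cmc_profile_def Let_def)
  show ?thesis
    unfolding cmc_iff_ode_s[OF assms(2)] quadratic_ode_pos[OF open_I connected_I I_nonempty \<omega>]
    using I_nonempty by (auto simp: profile)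
qed

lemma four_tau_sq_gt:
  assumes "\<kappa> < - H\<^sup>2"
  shows "\<kappa> < 4 * \<tau>\<^sup>2"
proof -
  have "- H\<^sup>2 \<le> 0" "0 \<le> 4 * \<tau>\<^sup>2"
    by simp_all
  then show ?thesis
    using assms by linarith
qed

lemma const_c_eq:
  assumes "\<kappa> \<noteq> 4 * \<tau>\<^sup>2"
  obtains k where "c = k * (4 * \<tau>\<^sup>2 - \<kappa>) - H * (1 - 2 * a * \<tau>)"
  using that[of "(c + H * (1 - 2 * a * \<tau>)) / (4 * \<tau>\<^sup>2 - \<kappa>)"] assms by simp

text \<open>Up to the factor \<open>l^2\<close> this is the discriminant for \<open>p\<close>, a sum
  of two nonnegative terms. The second vanishes only for \<open>k = 0\<close>, and then the first is
  4.\<close>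

lemma discriminant_pos:
  assumes "\<kappa> < - H\<^sup>2"
  shows "(const_b1 \<kappa> \<tau> H a c)\<^sup>2 + const_b \<kappa> \<tau> a c * (H\<^sup>2 + \<kappa>) > 0"
proof -
  define l where "l = (4 * \<tau>\<^sup>2 - \<kappa>) / 2"
  have l: "l > 0"
    unfolding l_def using four_tau_sq_gt[OF assms(1)] by simp
  obtain k where c: "c = k * (4 * \<tau>\<^sup>2 - \<kappa>) - H * (1 - 2 * a * \<tau>)"
    using four_tau_sq_gt[OF assms(1)] by (rule const_c_eq[OF less_imp_neq])
  have "(const_b1 \<kappa> \<tau> H a c)\<^sup>2 + const_b \<kappa> \<tau> a c * (H\<^sup>2 + \<kappa>) =
      l\<^sup>2 * ((2 - 2 * H * k)\<^sup>2 + 4 * k\<^sup>2 * (- (H\<^sup>2 + \<kappa>)))"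
    unfolding const_b_def const_b1_def c l_def by (simp add: field_simps) algebra
  moreover have "(2 - 2 * H * k)\<^sup>2 + 4 * k\<^sup>2 * (- (H\<^sup>2 + \<kappa>)) > 0"
  proof (cases "k = 0")
    case False
    then show ?thesis using assms by (intro add_nonneg_pos mult_pos_pos) auto
  qed simp
  ultimately show ?thesis
    using l by simp
qed

text \<open>With \<open>A = 2 - 2 H k\<close>, the first integral for \<open>p\<close> requires
  \<open>p (2 A - \<omega> p) \<ge> 0\<close>. But \<open>\<omega> p \<ge> A\<close> would give
  \<open>2 A - \<omega> p \<le> \<omega> p < 0\<close>, as \<open>p > 0\<close>. The bound
  \<open>\<omega> p < A\<close> is the claim after the affine substitution.\<close>

lemma ode_s_bound:
  assumes "\<kappa> < - H\<^sup>2" and u: "u \<in> I"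
    and ode: "quadratic_ode I (const_b \<kappa> \<tau> a c) (const_b1 \<kappa> \<tau> H a c) (H\<^sup>2 + \<kappa>) s"
  shows "(H\<^sup>2 + \<kappa>) * s u < const_b1 \<kappa> \<tau> H a c"
proof -
  define l where "l = (4 * \<tau>\<^sup>2 - \<kappa>) / 2"
  define \<omega> where "\<omega> = H\<^sup>2 + \<kappa>"
  have \<omega>: "\<omega> < 0" using assms(1) by (simp add: \<omega>_def)
  have l: "l > 0"
    unfolding l_def using four_tau_sq_gt[OF assms(1)] by simp
  obtain k where c: "c = k * (4 * \<tau>\<^sup>2 - \<kappa>) - H * (1 - 2 * a * \<tau>)"
    using four_tau_sq_gt[OF assms(1)] by (rule const_c_eq[OF less_imp_neq])
  define A where "A = 2 - 2 * H * k"
  have s: "s u = l * p u + (1 - 2 * a * \<tau>)"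
    unfolding s_eq[OF u] l_def by simp
  obtain D where D: "D\<^sup>2 = const_b \<kappa> \<tau> a c + 2 * const_b1 \<kappa> \<tau> H a c * s u - \<omega> * (s u)\<^sup>2"
    using ode u unfolding quadratic_ode_def \<omega>_def by blast
  have "D\<^sup>2 = l\<^sup>2 * (- 4 * k\<^sup>2 + p u * (2 * A - \<omega> * p u))"
    unfolding D s const_b_def const_b1_def c l_def A_def \<omega>_def
    by (simp add: field_simps) algebra
  then have *: "- 4 * k\<^sup>2 + p u * (2 * A - \<omega> * p u) \<ge> 0"
    using l by (metis zero_le_power2 zero_le_mult_iff zero_less_power not_less)
  have "\<omega> * p u < A"
  proof (rule ccontr)
    assume "\<not> \<omega> * p u < A"
    then have "2 * A - \<omega> * p u < 0"
      using mult_neg_pos[OF \<omega> p_pos[OF u]] by simp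
    then have "p u * (2 * A - \<omega> * p u) < 0"
      using p_pos[OF u] by (simp add: mult_pos_neg)
    then show False
      using * by (smt (verit) zero_le_power2)
  qed
  then have "l * (\<omega> * p u) < l * A"
    using l by simp
  moreover have "\<omega> * s u - const_b1 \<kappa> \<tau> H a c = l * (\<omega> * p u) - l * A"
    unfolding s const_b1_def c l_def A_def \<omega>_def by (simp add: field_simps power2_eq_square)
  ultimately show ?thesis
    unfolding \<omega>_def by linarith
qed

text \<open>\<open>discriminant_pos\<close> makes \<open>cmc_profile\<close> choose cosh, and
  \<open>ode_s_bound\<close> derives the side condition of \<open>quadratic_ode_neg\<close> from the
  equation itself.\<close>

lemma cmc_iff_hyperbolic:
  assumes "- H\<^sup>2 > \<kappa>" "\<kappa> \<noteq> 4 * \<tau>\<^sup>2"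
  shows "has_constant_mean_curvature (bcv_metric \<kappa> \<tau>) (I \<times> UNIV) \<psi> H \<longleftrightarrow>
    (\<exists>c u0. \<forall>u\<in>I. cmc_profile \<kappa> \<tau> H m a c (u - u0) (U u))"
proof -
  have \<omega>: "H\<^sup>2 + \<kappa> < 0"
    using assms(1) by simp
  have profile: "cmc_profile \<kappa> \<tau> H m a c v (U u) \<longleftrightarrow>
      s u = (const_b1 \<kappa> \<tau> H a c - sqrt ((const_b1 \<kappa> \<tau> H a c)\<^sup>2 + const_b \<kappa> \<tau> a c * (H\<^sup>2 + \<kappa>))
        * cosh (sqrt (- (H\<^sup>2 + \<kappa>)) * v)) / (H\<^sup>2 + \<kappa>)" if u: "u \<in> I" for c v u
    using assms discriminant_pos[OF assms(1), of c] unfolding U_iff_s_scaled[OF assms(2) u less_imp_neq[OF \<omega>], symmetric]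
    by (auto simp: cmc_profile_def Let_def)
  have "quadratic_ode I (const_b \<kappa> \<tau> a c) (const_b1 \<kappa> \<tau> H a c) (H\<^sup>2 + \<kappa>) s \<longleftrightarrow>
      (\<exists>u0. \<forall>u\<in>I. cmc_profile \<kappa> \<tau> H m a c (u - u0) (U u))" for c
    using quadratic_ode_neg[OF open_I connected_I I_nonempty \<omega> discriminant_pos[OF assms(1)], of c s]
      ode_s_bound[OF assms(1), of _ c] by (auto simp: profile)
  then show ?thesis
    unfolding cmc_iff_ode_s[OF assms(2)] by simp
qed

lemma cmc_iff_profile:
  "has_constant_mean_curvature (bcv_metric \<kappa> \<tau>) (I \<times> UNIV) \<psi> H \<longleftrightarrow>
    (\<exists>c u0. \<forall>u\<in>I. cmc_profile \<kappa> \<tau> H m a c (u - u0) (U u))"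
proof -
  consider "\<kappa> = 4 * \<tau>\<^sup>2" "\<kappa> = - H\<^sup>2" | "\<kappa> = 4 * \<tau>\<^sup>2" "\<kappa> \<noteq> - H\<^sup>2"
    | "\<kappa> \<noteq> 4 * \<tau>\<^sup>2" "- H\<^sup>2 = \<kappa>" | "\<kappa> \<noteq> 4 * \<tau>\<^sup>2" "- H\<^sup>2 < \<kappa>" | "\<kappa> \<noteq> 4 * \<tau>\<^sup>2" "- H\<^sup>2 > \<kappa>"
    by linarith
  then show ?thesis
  proof cases
    case 1
    then have "4 * \<tau>\<^sup>2 + H\<^sup>2 = 0" by simp
    then have "\<tau> = 0" "H = 0"
      by (simp_all add: add_nonneg_eq_0_iff)
    then show ?thesis using 1 cmc_iff_flat by simp
  next
    case 2
    then show ?thesis by (rule cmc_iff_space_form)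
  next
    case 3
    then show ?thesis by (rule cmc_iff_parabolic[rotated])
  next
    case 4
    then show ?thesis by (rule cmc_iff_elliptic[rotated])
  next
    case 5
    then show ?thesis by (rule cmc_iff_hyperbolic[rotated])
  qed
qed

end

theorem theorem4p3:
  fixes \<kappa> \<tau> H m a :: real and U :: "real \<Rightarrow> real" and I :: "real set"
    and \<psi> :: "real \<Rightarrow> real \<Rightarrow> real \<times> real \<times> real"
  assumes "m \<noteq> 0"
    and "helicoidal_surface \<kappa> \<tau> U m a I \<psi>"
  shows "(has_constant_mean_curvature (bcv_metric \<kappa> \<tau>) (I \<times> UNIV) \<psi> H \<longleftrightarrow>
            (\<exists>c u0. \<forall>u\<in>I. cmc_profile \<kappa> \<tau> H m a c (u - u0) (U u))) \<and>
         (\<forall>c. (\<forall>u\<in>I. cmc_profile \<kappa> \<tau> H m a c u (U u)) \<longrightarrow>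
            has_constant_mean_curvature (bcv_metric \<kappa> \<tau>) (I \<times> UNIV) \<psi> H)"
proof -
  obtain \<xi>2 \<Theta> where "bcv_helicoid \<kappa> \<tau> m a U I \<psi> \<xi>2 \<Theta>"
    using assms unfolding helicoidal_surface_def bcv_helicoid_def Let_def by blast
  then interpret bcv_helicoid \<kappa> \<tau> m a U I \<psi> \<xi>2 \<Theta> .
  show ?thesis
    \<comment> \<open>The second claim is the instance \<open>u0 = 0\<close> of the
      equivalence.\<close>
    unfolding cmc_iff_profile by (metis diff_zero)
qed

end
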